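(* For $n\ge 1$, let $Z_{3;\mathrm{sc}}(n)$ be the number of equivalence classes of triples $(\sigma_1,\sigma_2,\sigma_3)\in (S_n)^{\times 3}$ under the equivalence relation generated by $$(\sigma_1,\sigma_2,\sigma_3)\sim(\gamma_1\sigma_1\gamma_2,\gamma_1\sigma_2\gamma_2,\gamma_1\sigma_3\gamma_2)\quad(\gamma_1,\gamma_2\in S_n),\qquad (\sigma_1,\sigma_2,\sigma_3)\sim(\sigma_{\alpha(1)},\sigma_{\alpha(2)},\sigma_{\alpha(3)})\quad(\alpha\in S_3).$$ Then $$Z_{3;\mathrm{sc}}(n)=\tfrac16 S^{(3)}_{[1^3]}(n)+\tfrac12 S^{(3)}_{[2,1]}(n)+\tfrac13 S^{(3)}_{[3]}(n),$$ where $$S^{(3)}_{[1^3]}(n)=\frac1{n!}\sum_{\gamma,\sigma,\sigma'\in S_n}\delta(\gamma^{-1}\sigma\gamma\sigma^{-1})\,\delta(\gamma^{-1}\sigma'\gamma\sigma'^{-1})=\sum_{p\vdash n}\mathrm{Sym}(p),$$ $$S^{(3)}_{[2,1]}(n)=\frac1{n!}\sum_{\gamma,\sigma\in S_n}\delta(\gamma^2\sigma\gamma^{-2}\sigma^{-1})=\sum_{p\vdash n}\mathrm{Coeff}\big[Z^{(2)}(t,\vec x),\,t^n x_1^{p_1}\cdots x_n^{p_n}\big]\ \mathrm{Sym}(p),$$ $$S^{(3)}_{[3]}(n)=\frac1{n!}\sum_{\gamma,\sigma\in S_n}\delta(\gamma^3\sigma^3)=\sum_{p\vdash n}\Big(\mathrm{Coeff}\big[Z^{(3)}(t,\vec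 x),\,t^n x_1^{p_1}\cdots x_n^{p_n}\big]\Big)^2\ \mathrm{Sym}(p).$$
   Context: $S_n$ is the symmetric group on $\{1,\dots,n\}$; $\delta$ is the function on $S_n$ equal to $1$ at the identity and $0$ elsewhere. A partition $p\vdash n$ is written $p=(p_1,\dots,p_n)$ with $p_i$ the number of parts equal to $i$, $\sum_i ip_i=n$, and $\mathrm{Sym}(p)=\prod_{i=1}^n i^{p_i}p_i!$. $\mathrm{Coeff}[F,m]$ is the coefficient of the monomial $m$ in the formal power series $F$. With $\vec x=(x_1,x_2,\dots)$ let $Z^{(1)}(t,\vec x)=\exp\big(\sum_{i\ge1}t^ix_i/i\big)$. $Z^{(2)}(t,\vec x)$ is obtained from $Z^{(1)}(t,\vec x)$ by simultaneously replacing $x_i$ by $(x_{i/2})^2$ for every even $i$ (and leaving $x_i$ unchanged for odd $i$). $Z^{(3)}(t,\vec x)$ is obtained from $Z^{(1)}(t,\vec x)$ by simultaneously replacing $x_i$ by $(x_{i/3})^3$ for every $i$ divisible by $3$ (and leaving the other $x_i$ unchanged). *)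

theory Defs
  imports
    "HOL-Combinatorics.Permutations"
    "HOL-Library.FuncSet"
    "HOL-Library.Poly_Mapping"
    "HOL-Computational_Algebra.Formal_Power_Series"
begin

definition Sn :: "nat \<Rightarrow> (nat \<Rightarrow> nat) set" where
  "Sn n = {\<sigma>. \<sigma> permutes {1..n}}"

definition delta :: "(nat \<Rightarrow> nat) \<Rightarrow> rat" where
  "delta \<sigma> = (if \<sigma> = id then 1 else 0)"

definition triples :: "nat \<Rightarrow> (nat \<Rightarrow> nat \<Rightarrow> nat) set" where
  "triples n = {1..3} \<rightarrow>\<^sub>E Sn n"

inductive triple_step :: "nat \<Rightarrow> (nat \<Rightarrow> nat \<Rightarrow> nat) \<Rightarrow> (nat \<Rightarrow> nat \<Rightarrow> nat) \<Rightarrow> bool"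
  for n :: nat where
  multiply: "\<sigma> \<in> triples n \<Longrightarrow> \<gamma>\<^sub>1 \<in> Sn n \<Longrightarrow> \<gamma>\<^sub>2 \<in> Sn n \<Longrightarrow>
    triple_step n \<sigma> (\<lambda>i\<in>{1..3}. \<gamma>\<^sub>1 \<circ> \<sigma> i \<circ> \<gamma>\<^sub>2)"
| relabel: "\<sigma> \<in> triples n \<Longrightarrow> \<alpha> permutes {1..3} \<Longrightarrow>
    triple_step n \<sigma> (\<lambda>i\<in>{1..3}. \<sigma> (\<alpha> i))"

definition Z3sc :: "nat \<Rightarrow> nat" where
  "Z3sc n = card (triples n // {(\<sigma>, \<tau>). equivclp (triple_step n) \<sigma> \<tau>})"

text \<open>
  A partition is given by its finitely supported multiplicity function: \<open>lookup p i\<close> is the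
  number of parts equal to \<open>i\<close>. The same object serves as the exponent vector of the
  monomial in \<open>x\<^sub>1, x\<^sub>2, \<dots>\<close> in which \<open>x\<^sub>i\<close> is raised to \<open>lookup p i\<close>.
\<close>

definition partitions :: "nat \<Rightarrow> (nat \<Rightarrow>\<^sub>0 nat) set" where
  "partitions n = {p. Poly_Mapping.keys p \<subseteq> {1..n} \<and>
     (\<Sum>i=1..n. i * Poly_Mapping.lookup p i) = n}"

definition Sym :: "nat \<Rightarrow> (nat \<Rightarrow>\<^sub>0 nat) \<Rightarrow> nat" where
  "Sym n p = (\<Prod>i=1..n. i ^ Poly_Mapping.lookup p i * fact (Poly_Mapping.lookup p i))"

text \<open>
  A polynomial in \<open>x\<^sub>1, x\<^sub>2, \<dots>\<close> maps the exponent vector of each monomial to its coefficient, the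
  product on \<open>\<Rightarrow>\<^sub>0\<close> being convolution. In all series below the coefficient of each
  power of \<open>t\<close> is such a polynomial, so they are power series in \<open>t\<close> over this ring.
\<close>

type_synonym xpoly = "(nat \<Rightarrow>\<^sub>0 nat) \<Rightarrow>\<^sub>0 rat"

definition Const :: "rat \<Rightarrow> xpoly" where
  "Const c = Poly_Mapping.single 0 c"

definition X :: "nat \<Rightarrow> xpoly" where
  "X i = Poly_Mapping.single (Poly_Mapping.single i 1) 1"

definition Coeff :: "xpoly fps \<Rightarrow> nat \<Rightarrow> (nat \<Rightarrow>\<^sub>0 nat) \<Rightarrow> rat" where
  "Coeff F n m = Poly_Mapping.lookup (fps_nth F n) m"

text \<open>
  \<open>fps_exp\<close> itself is only available over fields. As for every \<open>fps_compose\<close>, the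
  value is meaningful only if \<open>F\<close> has constant term 0.
\<close>

definition exp_series :: "xpoly fps \<Rightarrow> xpoly fps" where
  "exp_series F = fps_compose (Abs_fps (\<lambda>k. Const (1 / fact k))) F"

definition subst_poly :: "(nat \<Rightarrow> xpoly) \<Rightarrow> xpoly \<Rightarrow> xpoly" where
  "subst_poly f q = (\<Sum>m\<in>Poly_Mapping.keys q.
     Const (Poly_Mapping.lookup q m) *
     (\<Prod>i\<in>Poly_Mapping.keys m. f i ^ Poly_Mapping.lookup m i))"

definition subst_series :: "(nat \<Rightarrow> xpoly) \<Rightarrow> xpoly fps \<Rightarrow> xpoly fps" where
  "subst_series f F = Abs_fps (\<lambda>n. subst_poly f (fps_nth F n))"

definition Z1 :: "xpoly fps" where
  "Z1 = exp_series (Abs_fps (\<lambda>i. if i = 0 then 0 else Const (1 / of_nat i) * X i))"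

definition Z2 :: "xpoly fps" where
  "Z2 = subst_series (\<lambda>i. if 2 dvd i then X (i div 2) ^ 2 else X i) Z1"

definition Z3 :: "xpoly fps" where
  "Z3 = subst_series (\<lambda>i. if 3 dvd i then X (i div 3) ^ 3 else X i) Z1"

definition S3_111 :: "nat \<Rightarrow> rat" where
  "S3_111 n = 1 / fact n * (\<Sum>\<gamma>\<in>Sn n. \<Sum>\<sigma>\<in>Sn n. \<Sum>\<sigma>'\<in>Sn n.
     delta (inv \<gamma> \<circ> \<sigma> \<circ> \<gamma> \<circ> inv \<sigma>) * delta (inv \<gamma> \<circ> \<sigma>' \<circ> \<gamma> \<circ> inv \<sigma>'))"

definition S3_21 :: "nat \<Rightarrow> rat" where
  "S3_21 n = 1 / fact n * (\<Sum>\<gamma>\<in>Sn n. \<Sum>\<sigma>\<in>Sn n.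
     delta ((\<gamma> ^^ 2) \<circ> \<sigma> \<circ> inv (\<gamma> ^^ 2) \<circ> inv \<sigma>))"

definition S3_3 :: "nat \<Rightarrow> rat" where
  "S3_3 n = 1 / fact n * (\<Sum>\<gamma>\<in>Sn n. \<Sum>\<sigma>\<in>Sn n. delta ((\<gamma> ^^ 3) \<circ> (\<sigma> ^^ 3)))"

end

theory Submission
  imports Defs "HOL-Combinatorics.Cycles" "HOL-Computational_Algebra.Primes"
begin

text \<open>
  The relation on triples is the orbit relation of \<open>S\<^sub>n \<times> S\<^sub>n \<times> S\<^sub>3\<close>, so orbit counting expresses
  the number of classes through the fixed points of each \<open>\<alpha> \<in> S\<^sub>3\<close>. Solving the
  fixed-point equations for \<open>\<gamma>\<^sub>2\<close> leaves a free factor \<open>n!\<close> and counts pairs of elements in the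
  centralizer of \<open>\<gamma>\<close> (identity), elements in the centralizer of \<open>\<gamma>\<^sup>2\<close> (transpositions), and solutions of
  \<open>\<gamma>\<^sup>3\<sigma>\<^sup>3 = 1\<close> (3-cycles).

  Counting the bijections that intertwine two permutations, one cycle at a time, gives \<open>Sym(p)\<close> if
  both have cycle type \<open>p\<close> and \<open>0\<close> otherwise; this yields at once the order of centralizers, the
  conjugacy criterion, and the class sizes \<open>n!/Sym(p)\<close>. The differential equation
  \<open>Z' = Z \<cdot> \<Sum>\<^sub>i t\<^sup>i x\<^sub>i\<^sub>+\<^sub>1\<close> shows that \<open>Z\<^sup>(\<^sup>1\<^sup>)\<close> has coefficients \<open>1/Sym(p)\<close>. For a prime \<open>k\<close>, the
  \<open>k\<close>-th power splits each cycle whose length \<open>i\<close> is divisible by \<open>k\<close> into \<open>k\<close> cycles of length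
  \<open>i/k\<close> and preserves the other lengths. This is the substitution defining \<open>Z\<^sup>(\<^sup>2\<^sup>)\<close> and \<open>Z\<^sup>(\<^sup>3\<^sup>)\<close>, so
  \<open>n!\<close> times their coefficients count the permutations whose \<open>k\<close>-th power has a given type.
\<close>

section \<open>Cycle types\<close>

lemma restrict_permutes:
  assumes "bij_betw f A A"
  shows "(\<lambda>x. if x \<in> A then f x else x) permutes A"
proof (rule bij_imp_permutes)
  show "bij_betw (\<lambda>x. if x \<in> A then f x else x) A A"
    using assms by (simp cong: bij_betw_cong)
qed simp

lemma funpow_in:
  assumes "bij_betw f A A" "x \<in> A"
  shows "(f ^^ k) x \<in> A"
  using assms by (induction k) (auto simp: bij_betw_apply)

text \<open>Extending \<open>f\<close> by the identity outside \<open>A\<close> gives a permutation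
  of the whole type with the same iterates at \<open>x\<close>. Its period is a positive return
  time, so \<open>f\<close> has a least one.\<close>

lemma least_power_on:
  assumes "finite A" "bij_betw f A A" "x \<in> A"
  shows "(f ^^ least_power f x) x = x" and "least_power f x > 0"
proof -
  let ?p = "\<lambda>x. if x \<in> A then f x else x"
  have "(?p ^^ k) x = (f ^^ k) x" for k
    using assms(3) funpow_in[OF assms(2,3)] by (induction k) auto
  moreover have "permutation ?p"
    using restrict_permutes[OF assms(2)] assms(1) permutation_permutes by blast
  ultimately have "(f ^^ least_power ?p x) x = x" "least_power ?p x > 0"
    using least_power_of_permutation[of ?p x] by auto
  then show "(f ^^ least_power f x) x = x" and "least_power f x > 0"
    using least_powerI by metis+
qed

lemma least_power_dvd_on:
  assumes "finite A" "bij_betw f A A" "x \<in> A"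
  shows "least_power f x dvd n \<longleftrightarrow> (f ^^ n) x = x"
proof
  assume "least_power f x dvd n"
  then show "(f ^^ n) x = x"
    using funpow_mod_eq[OF least_power_on(1)[OF assms], of n]
    by (metis dvd_imp_mod_0 funpow_0)
qed (rule least_power_minimal)

lemma funpow_inj_on:
  assumes "bij_betw f A A"
  shows "inj_on (f ^^ k) A"
  using bij_betw_funpow[OF assms] bij_betw_imp_inj_on by blast

text \<open>Iterates are injective on \<open>A\<close>, so the smaller exponent cancels; what
  remains is a return to \<open>x\<close>, governed by divisibility by the period.\<close>

lemma funpow_eq_iff_mod:
  assumes "finite A" "bij_betw f A A" "x \<in> A"
  shows "(f ^^ k) x = (f ^^ l) x \<longleftrightarrow> k mod least_power f x = l mod least_power f x"
proof -
  have main: "(f ^^ k) x = (f ^^ l) x \<longleftrightarrow> k mod least_power f x = l mod least_power f x"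
    if "k \<le> l" for k l
  proof -
    have "(f ^^ l) x = (f ^^ k) ((f ^^ (l - k)) x)"
      using that by (metis comp_apply funpow_add le_add_diff_inverse)
    then have "(f ^^ k) x = (f ^^ l) x \<longleftrightarrow> x = (f ^^ (l - k)) x"
      using inj_onD[OF funpow_inj_on[OF assms(2)], of k x "(f ^^ (l - k)) x"]
        funpow_in[OF assms(2,3)] assms(3) by auto
    also have "\<dots> \<longleftrightarrow> least_power f x dvd l - k"
      using least_power_dvd_on[OF assms] by metis
    also have "\<dots> \<longleftrightarrow> k mod least_power f x = l mod least_power f x"
      using that mod_eq_dvd_iff_nat by metis
    finally show ?thesis .
  qed
  show ?thesis
    using main[of k l] main[of l k] by (cases "k \<le> l") auto
qed

text \<open>Forward iterates suffice: on a finite set permuted by \<open>f\<close> they already run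
  through the whole cycle.\<close>

definition cycle_of :: "('a \<Rightarrow> 'a) \<Rightarrow> 'a \<Rightarrow> 'a set" where
  "cycle_of f x = range (\<lambda>k. (f ^^ k) x)"

lemma cycle_of_eq:
  assumes "finite A" "bij_betw f A A" "x \<in> A"
  shows "cycle_of f x = (\<lambda>k. (f ^^ k) x) ` {..<least_power f x}"
proof -
  have "(f ^^ k) x \<in> (\<lambda>k. (f ^^ k) x) ` {..<least_power f x}" for k
    by (metis assms funpow_mod_eq imageI least_power_on lessThan_iff mod_less_divisor)
  then show ?thesis
    unfolding cycle_of_def by auto
qed

lemma card_cycle_of:
  assumes "finite A" "bij_betw f A A" "x \<in> A"
  shows "card (cycle_of f x) = least_power f x"
proof -
  have "inj_on (\<lambda>k. (f ^^ k) x) {..<least_power f x}"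
    by (rule inj_onI) (simp add: funpow_eq_iff_mod[OF assms])
  then show ?thesis
    unfolding cycle_of_eq[OF assms] by (simp add: card_image)
qed

lemma cycle_of_subset:
  assumes "bij_betw f A A" "x \<in> A"
  shows "cycle_of f x \<subseteq> A"
  unfolding cycle_of_def using funpow_in[OF assms] by auto

lemma self_in_cycle_of: "x \<in> cycle_of f x"
  unfolding cycle_of_def by (metis funpow_0 rangeI)

lemma bij_betw_cycle_of:
  assumes "finite A" "bij_betw f A A" "x \<in> A"
  shows "bij_betw f (cycle_of f x) (cycle_of f x)"
proof -
  have "f ` cycle_of f x \<subseteq> cycle_of f x"
    unfolding cycle_of_def by (auto intro: range_eqI[of _ _ "Suc _"])
  moreover have "inj_on f (cycle_of f x)"
    using assms cycle_of_subset bij_betw_imp_inj_on inj_on_subset by metis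
  moreover have "finite (cycle_of f x)"
    using assms cycle_of_subset finite_subset by metis
  ultimately show ?thesis
    by (simp add: bij_betw_def endo_inj_surj)
qed

lemma bij_betw_remove:
  assumes "bij_betw f A B" "bij_betw f C D" "C \<subseteq> A"
  shows "bij_betw f (A - C) (B - D)"
  using assms by (simp add: bij_betw_DiffI bij_betw_def) (metis inj_on_image_set_diff inj_on_subset subset_refl inj_on_diff Diff_subset)

text \<open>If \<open>y = (f ^^ k) x\<close>, injectivity of \<open>f ^^ k\<close> gives
  \<open>x\<close> and \<open>y\<close> the same return times.\<close>

lemma least_power_cycle_of:
  assumes "finite A" "bij_betw f A A" "x \<in> A" "y \<in> cycle_of f x"
  shows "least_power f y = least_power f x"
proof -
  obtain k where y: "y = (f ^^ k) x"
    using assms(4) unfolding cycle_of_def by auto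
  have "(f ^^ n) y = y \<longleftrightarrow> (f ^^ n) x = x" for n
  proof -
    have "(f ^^ n) y = (f ^^ k) ((f ^^ n) x)"
      unfolding y by (metis add.commute comp_apply funpow_add)
    then show ?thesis
      using inj_onD[OF funpow_inj_on[OF assms(2)], of k "(f ^^ n) x" x]
        funpow_in[OF assms(2,3)] assms(3) y by auto
  qed
  then show ?thesis
    unfolding least_power_def by simp
qed

text \<open>Points on \<open>i\<close>-cycles are counted instead of the cycles themselves: for a
  permutation this is \<open>i\<close> times the number of \<open>i\<close>-cycles, and the count is
  additive over disjoint pieces without handling sets of cycles.\<close>

definition period_count :: "('a \<Rightarrow> 'a) \<Rightarrow> 'a set \<Rightarrow> nat \<Rightarrow> nat" where
  "period_count f A i = card {x \<in> A. least_power f x = i}"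

lemma period_count_remove:
  assumes "finite A" "bij_betw f A A" "x \<in> A"
  shows "period_count f A j =
    period_count f (A - cycle_of f x) j + (if j = least_power f x then j else 0)"
proof -
  have fin: "finite (cycle_of f x)"
    using assms cycle_of_subset finite_subset by metis
  have "{y \<in> A. least_power f y = j} = {y \<in> A - cycle_of f x. least_power f y = j} \<union>
      (if j = least_power f x then cycle_of f x else {})"
    using cycle_of_subset[OF assms(2,3)] least_power_cycle_of[OF assms] by auto
  then have "period_count f A j = card ({y \<in> A - cycle_of f x. least_power f y = j} \<union>
      (if j = least_power f x then cycle_of f x else {}))"
    unfolding period_count_def by simp
  also have "\<dots> = period_count f (A - cycle_of f x) j +
      card (if j = least_power f x then cycle_of f x else {})"
    unfolding period_count_def by (rule card_Un_disjoint) (use assms fin in auto)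
  finally show ?thesis
    using card_cycle_of[OF assms] by auto
qed

lemma bij_betw_remove_cycle_of:
  assumes "finite A" "bij_betw f A A" "x \<in> A"
  shows "bij_betw f (A - cycle_of f x) (A - cycle_of f x)"
    and "card (A - cycle_of f x) < card A"
proof -
  show "bij_betw f (A - cycle_of f x) (A - cycle_of f x)"
    using bij_betw_remove[OF assms(2) bij_betw_cycle_of[OF assms] cycle_of_subset[OF assms(2,3)]] .
  show "card (A - cycle_of f x) < card A"
    using assms self_in_cycle_of[of x f] by (intro psubset_card_mono) auto
qed

text \<open>Cycles are stripped off one at a time; each contributes \<open>j\<close> points or
  none.\<close>

lemma dvd_period_count:
  assumes "finite A" "bij_betw f A A"
  shows "j dvd period_count f A j"
  using assms
proof (induction "card A" arbitrary: A rule: less_induct)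
  case less
  show ?case
  proof (cases "A = {}")
    case False
    then obtain x where x: "x \<in> A" by auto
    have "j dvd period_count f (A - cycle_of f x) j"
      using less bij_betw_remove_cycle_of[OF less.prems x] by simp
    then show ?thesis
      using period_count_remove[OF less.prems x, of j] by simp
  qed (simp add: period_count_def)
qed

text \<open>The division is exact for a permutation of a finite set, and division by 0 makes the
  multiplicity at 0 vanish.\<close>

definition cycle_type :: "('a \<Rightarrow> 'a) \<Rightarrow> 'a set \<Rightarrow> (nat \<Rightarrow>\<^sub>0 nat)" where
  "cycle_type f A = Abs_poly_mapping (\<lambda>i. period_count f A i div i)"

lemma lookup_cycle_type:
  assumes "finite A"
  shows "Poly_Mapping.lookup (cycle_type f A) i = period_count f A i div i"
proof -
  have "{i. period_count f A i div i \<noteq> 0} \<subseteq> least_power f ` A"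
  proof
    fix i assume "i \<in> {i. period_count f A i div i \<noteq> 0}"
    then have "period_count f A i \<noteq> 0"
      by (metis (mono_tags) div_0 mem_Collect_eq)
    then have "{x \<in> A. least_power f x = i} \<noteq> {}"
      unfolding period_count_def by (metis card.empty)
    then show "i \<in> least_power f ` A" by auto
  qed
  then have "finite {i. period_count f A i div i \<noteq> 0}"
    using assms finite_surj by auto
  then show ?thesis
    unfolding cycle_type_def by simp
qed

lemma period_count_eq:
  assumes "finite A" "bij_betw f A A"
  shows "period_count f A i = i * Poly_Mapping.lookup (cycle_type f A) i"
  using dvd_period_count[OF assms] lookup_cycle_type[OF assms(1)] by simp

lemma cycle_type_empty: "cycle_type f {} = 0"
  by (rule poly_mapping_eqI) (simp add: lookup_cycle_type period_count_def)

lemma cycle_type_remove: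
  assumes "finite A" "bij_betw f A A" "x \<in> A"
  shows "cycle_type f A =
    cycle_type f (A - cycle_of f x) + Poly_Mapping.single (least_power f x) 1"
  using assms least_power_on(2)[OF assms]
  by (intro poly_mapping_eqI)
    (simp add: lookup_cycle_type period_count_remove[OF assms] lookup_add lookup_single when_def)

lemma cycle_type_eq_0_iff:
  assumes "finite A" "bij_betw f A A"
  shows "cycle_type f A = 0 \<longleftrightarrow> A = {}"
proof
  assume *: "cycle_type f A = 0"
  show "A = {}"
  proof (rule ccontr)
    assume "A \<noteq> {}"
    then obtain x where "x \<in> A" by auto
    then have "Poly_Mapping.lookup (cycle_type f A) (least_power f x) \<noteq> 0"
      using cycle_type_remove[OF assms] by (simp add: lookup_add)
    then show False using * by simp
  qed
qed (simp add: cycle_type_empty)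

section \<open>Intertwining bijections\<close>

text \<open>Maps are extensional so that each bijection is counted once. Non-emptiness means that
  \<open>f\<close> and \<open>g\<close> are conjugate; for equal arguments the set is a
  centralizer.\<close>

definition intertwiners :: "('a \<Rightarrow> 'a) \<Rightarrow> 'a set \<Rightarrow> ('b \<Rightarrow> 'b) \<Rightarrow> 'b set \<Rightarrow> ('a \<Rightarrow> 'b) set" where
  "intertwiners f A g B = {h \<in> A \<rightarrow>\<^sub>E B. bij_betw h A B \<and> (\<forall>x\<in>A. h (f x) = g (h x))}"

lemma intertwiner_funpow:
  assumes "bij_betw f A A" "\<forall>x\<in>A. h (f x) = g (h x)" "x \<in> A"
  shows "h ((f ^^ k) x) = (g ^^ k) (h x)"
  using assms funpow_in[OF assms(1,3)] by (induction k) auto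

lemma intertwiner_cycle_of:
  assumes "bij_betw f A A" "\<forall>x\<in>A. h (f x) = g (h x)" "x \<in> A"
  shows "h ` cycle_of f x = cycle_of g (h x)"
  unfolding cycle_of_def using intertwiner_funpow[OF assms]
  by (simp add: image_image)

lemma intertwiner_least_power:
  assumes "bij_betw f A A" "\<forall>x\<in>A. h (f x) = g (h x)" "x \<in> A" "inj_on h A"
  shows "least_power g (h x) = least_power f x"
proof -
  have "(g ^^ k) (h x) = h x \<longleftrightarrow> (f ^^ k) x = x" for k
    unfolding intertwiner_funpow[OF assms(1-3), symmetric]
    using inj_onD[OF assms(4), of "(f ^^ k) x" x] assms(3)
      funpow_in[OF assms(1,3)] by auto
  then show ?thesis
    unfolding least_power_def by simp
qed

text \<open>The assignment of \<open>(g ^^ k) b\<close> to \<open>(f ^^ k) a\<close> is forced.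
  Equal periods make iterates coincide on both sides for the same pairs of exponents, which gives
  well-definedness and injectivity at once.\<close>

lemma cycle_intertwiner_exists:
  assumes "finite A" "bij_betw f A A" "a \<in> A"
    and "finite B" "bij_betw g B B" "b \<in> B"
    and "least_power f a = least_power g b"
  obtains h where "bij_betw h (cycle_of f a) (cycle_of g b)"
    and "\<forall>x\<in>cycle_of f a. h (f x) = g (h x)" and "h a = b"
proof -
  \<comment> \<open>Any exponent reaching \<open>x\<close> may be chosen: the equivalence proved
    next makes the value independent of the choice.\<close>
  define h where "h x = (g ^^ (SOME k. (f ^^ k) a = x)) b" for x
  have *: "(f ^^ k) a = (f ^^ l) a \<longleftrightarrow> (g ^^ k) b = (g ^^ l) b" for k l
    unfolding funpow_eq_iff_mod[OF assms(1-3)] funpow_eq_iff_mod[OF assms(4-6)] assms(7) ..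
  have h: "h ((f ^^ k) a) = (g ^^ k) b" for k
    unfolding h_def using someI[of "\<lambda>l. (f ^^ l) a = (f ^^ k) a" k] * by blast
  have "h ` cycle_of f a = cycle_of g b"
    unfolding cycle_of_def by (simp add: image_image h)
  moreover have "inj_on h (cycle_of f a)"
    unfolding cycle_of_def by (auto simp: inj_on_def h *)
  moreover have "h (f x) = g (h x)" if x: "x \<in> cycle_of f a" for x
  proof -
    obtain k where k: "x = (f ^^ k) a"
      using x unfolding cycle_of_def by auto
    show ?thesis
      using h[of "Suc k"] h[of k] by (simp add: k)
  qed
  moreover have "h a = b"
    using h[of 0] by simp
  ultimately show ?thesis
    using that[of h] unfolding bij_betw_def by blast
qed

text \<open>On the cycle of \<open>a\<close> an intertwiner is determined by the image
  \<open>b\<close> of \<open>a\<close>, which can be any point of the same period. On the complement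
  it is an arbitrary intertwiner into the complement of the cycle of \<open>b\<close>, and the two
  pieces glue freely.\<close>

lemma bij_betw_intertwiners_remove:
  assumes "finite A" "bij_betw f A A" "a \<in> A"
    and "finite B" "bij_betw g B B"
  shows "bij_betw (\<lambda>h. (h a, restrict h (A - cycle_of f a))) (intertwiners f A g B)
    (SIGMA b:{b \<in> B. least_power g b = least_power f a}.
      intertwiners f (A - cycle_of f a) g (B - cycle_of g b))" (is "bij_betw ?F ?I ?S")
proof -
  let ?C = "cycle_of f a"
  have CA: "?C \<subseteq> A"
    using cycle_of_subset[OF assms(2,3)] .
  have fC: "f x \<in> ?C" if "x \<in> ?C" for x
    using bij_betw_cycle_of[OF assms(1-3)] that bij_betw_apply by metis
  have fA: "f x \<in> A - ?C" if "x \<in> A - ?C" for x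
    using bij_betw_remove_cycle_of(1)[OF assms(1-3)] that bij_betw_apply by metis
  have "inj_on ?F ?I"
  proof (rule inj_onI)
    fix h h'
    assume h: "h \<in> ?I" and h': "h' \<in> ?I" and eq: "?F h = ?F h'"
    show "h = h'"
    proof (rule PiE_ext[of h A "\<lambda>_. B"])
      show "h \<in> A \<rightarrow>\<^sub>E B" "h' \<in> A \<rightarrow>\<^sub>E B"
        using h h' unfolding intertwiners_def by auto
      fix x assume x: "x \<in> A"
      show "h x = h' x"
      proof (cases "x \<in> ?C")
        case True
        then obtain k where "x = (f ^^ k) a"
          unfolding cycle_of_def by auto
        then show ?thesis
          using h h' eq intertwiner_funpow[OF assms(2) _ assms(3), of h g k]
            intertwiner_funpow[OF assms(2) _ assms(3), of h' g k]
          unfolding intertwiners_def by simp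
      next
        case False
        then show ?thesis
          using eq x by (metis DiffI prod.inject restrict_apply')
      qed
    qed
  qed
  moreover have "?F h \<in> ?S" if "h \<in> ?I" for h
  proof -
    have h: "bij_betw h A B" "\<forall>x\<in>A. h (f x) = g (h x)"
      using that unfolding intertwiners_def by auto
    have lp: "least_power g (h a) = least_power f a"
      using intertwiner_least_power[OF assms(2) h(2) assms(3)] h(1) bij_betw_imp_inj_on by blast
    have "bij_betw h ?C (cycle_of g (h a))"
      using intertwiner_cycle_of[OF assms(2) h(2) assms(3)] h(1) CA
      by (metis bij_betw_subset subset_refl)
    then have bij: "bij_betw h (A - ?C) (B - cycle_of g (h a))"
      using bij_betw_remove[OF h(1) _ CA] by blast
    then have "restrict h (A - ?C) \<in> intertwiners f (A - ?C) g (B - cycle_of g (h a))"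
      using fA h(2) unfolding intertwiners_def
      using bij_betw_apply[OF bij] by (auto simp: bij_betw_restrict_eq)
    then show ?thesis
      using lp h(1) assms(3) by (auto simp: bij_betw_apply)
  qed
  moreover have "s \<in> ?F ` ?I" if s: "s \<in> ?S" for s
  proof -
    obtain b h1 where sb: "s = (b, h1)" and b: "b \<in> B" "least_power f a = least_power g b"
      and h1: "h1 \<in> intertwiners f (A - ?C) g (B - cycle_of g b)"
      using s by auto
    obtain h2 where h2: "bij_betw h2 ?C (cycle_of g b)"
        "\<forall>x\<in>?C. h2 (f x) = g (h2 x)" "h2 a = b"
      using cycle_intertwiner_exists[OF assms b] .
    have h1': "bij_betw h1 (A - ?C) (B - cycle_of g b)"
      "\<forall>x\<in>A - ?C. h1 (f x) = g (h1 x)" "h1 \<in> extensional (A - ?C)"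
      using h1 unfolding intertwiners_def by (auto simp: PiE_def)
    define h where "h x = (if x \<in> ?C then h2 x else h1 x)" for x
    have hC: "h x = h2 x" if "x \<in> ?C" for x
      using that unfolding h_def by simp
    have hA: "h x = h1 x" if "x \<notin> ?C" for x
      using that unfolding h_def by simp
    have "bij_betw h ?C (cycle_of g b)"
      using h2(1) hC by (simp cong: bij_betw_cong)
    moreover have "bij_betw h (A - ?C) (B - cycle_of g b)"
      using h1'(1) hA by (subst bij_betw_cong[of _ h h1]) auto
    ultimately have "bij_betw h (?C \<union> (A - ?C)) (cycle_of g b \<union> (B - cycle_of g b))"
      by (rule bij_betw_combine) auto
    then have bij: "bij_betw h A B"
      using CA cycle_of_subset[OF assms(5) b(1)] by (simp add: Un_absorb1)
    have "h (f x) = g (h x)" if "x \<in> A" for x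
    proof (cases "x \<in> ?C")
      case True
      then show ?thesis using fC h2(2) hC by simp
    next
      case False
      then show ?thesis using fA[of x] that h1'(2) hA by simp
    qed
    \<comment> \<open>Outside \<open>A\<close> the glued map inherits the default value of the
      extensional \<open>h1\<close>, as required for membership in the extensional function
      space.\<close>
    moreover have "h x = undefined" if "x \<notin> A" for x
    proof -
      have "x \<notin> ?C" using that CA by auto
      then show ?thesis using that hA h1'(3) by (simp add: extensional_def)
    qed
    then have "h \<in> A \<rightarrow>\<^sub>E B"
      using bij by (auto simp: bij_betw_apply)
    ultimately have "h \<in> ?I"
      unfolding intertwiners_def using bij by auto
    moreover have "?F h = s"
    proof -
      have "h a = b"
        using hC[OF self_in_cycle_of] h2(3) by simp
      moreover have "restrict h (A - ?C) = h1"
        using h1'(3) hA by (auto simp: fun_eq_iff extensional_def)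
      ultimately show ?thesis
        using sb by simp
    qed
    ultimately show ?thesis by blast
  qed
  ultimately show ?thesis
    unfolding bij_betw_def by blast
qed

text \<open>\<open>Sym\<close> freed from the ambient size \<open>n\<close>: the product runs over
  the parts that occur, so inductions can pass to smaller sets.\<close>

definition sym_size :: "(nat \<Rightarrow>\<^sub>0 nat) \<Rightarrow> nat" where
  "sym_size p = (\<Prod>i\<in>Poly_Mapping.keys p.
     i ^ Poly_Mapping.lookup p i * fact (Poly_Mapping.lookup p i))"

lemma sym_size_superset:
  assumes "finite S" "Poly_Mapping.keys p \<subseteq> S"
  shows "sym_size p = (\<Prod>i\<in>S. i ^ Poly_Mapping.lookup p i * fact (Poly_Mapping.lookup p i))"
  unfolding sym_size_def using assms
  by (intro prod.mono_neutral_left) (auto simp: in_keys_iff)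

lemma sym_size_0: "sym_size 0 = 1"
  unfolding sym_size_def by simp

text \<open>Only the factor at \<open>i\<close> changes, gaining one power of \<open>i\<close> and
  one step of the factorial.\<close>

lemma sym_size_add_single:
  "sym_size (p + Poly_Mapping.single i 1) = i * (Poly_Mapping.lookup p i + 1) * sym_size p"
proof -
  let ?S = "insert i (Poly_Mapping.keys p)"
  let ?q = "p + Poly_Mapping.single i 1"
  have rest: "(\<Prod>j\<in>?S - {i}. j ^ Poly_Mapping.lookup ?q j * fact (Poly_Mapping.lookup ?q j)) =
      (\<Prod>j\<in>?S - {i}. j ^ Poly_Mapping.lookup p j * fact (Poly_Mapping.lookup p j))"
    by (rule prod.cong) (auto simp: lookup_add lookup_single)
  have "sym_size ?q = (\<Prod>j\<in>?S. j ^ Poly_Mapping.lookup ?q j * fact (Poly_Mapping.lookup ?q j))"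
    by (rule sym_size_superset) (auto simp: in_keys_iff lookup_add lookup_single when_def split: if_splits)
  also have "\<dots> = i ^ Poly_Mapping.lookup ?q i * fact (Poly_Mapping.lookup ?q i) *
      (\<Prod>j\<in>?S - {i}. j ^ Poly_Mapping.lookup p j * fact (Poly_Mapping.lookup p j))"
    unfolding rest[symmetric] by (rule prod.remove) auto
  also have "\<dots> = i * (Poly_Mapping.lookup p i + 1) * (i ^ Poly_Mapping.lookup p i *
      fact (Poly_Mapping.lookup p i) *
      (\<Prod>j\<in>?S - {i}. j ^ Poly_Mapping.lookup p j * fact (Poly_Mapping.lookup p j)))"
    by (simp add: lookup_add algebra_simps)
  also have "i ^ Poly_Mapping.lookup p i * fact (Poly_Mapping.lookup p i) *
      (\<Prod>j\<in>?S - {i}. j ^ Poly_Mapping.lookup p j * fact (Poly_Mapping.lookup p j)) =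
      (\<Prod>j\<in>?S. j ^ Poly_Mapping.lookup p j * fact (Poly_Mapping.lookup p j))"
    by (rule prod.remove[symmetric]) auto
  also have "\<dots> = sym_size p"
    by (rule sym_size_superset[symmetric]) auto
  finally show ?thesis .
qed

text \<open>Removing the cycle of one point \<open>a\<close> of period \<open>i\<close> leaves, for
  equal types, as many choices for its image as \<open>g\<close> has points of period
  \<open>i\<close>, namely \<open>i\<close> times the multiplicity of \<open>i\<close>. This is the
  factor by which \<open>sym_size\<close> grows when the part \<open>i\<close> is put back.\<close>

theorem card_intertwiners:
  assumes "finite A" "bij_betw f A A" "finite B" "bij_betw g B B"
  shows "card (intertwiners f A g B) =
    (if cycle_type f A = cycle_type g B then sym_size (cycle_type f A) else 0)"
  using assms
proof (induction "card A" arbitrary: A B rule: less_induct)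
  case less
  note A = less.prems(1,2) and B = less.prems(3,4)
  show ?case
  proof (cases "A = {}")
    case True
    have "intertwiners f A g B = (if B = {} then {\<lambda>_. undefined} else {})"
      unfolding True intertwiners_def by (auto simp: bij_betw_def)
    then show ?thesis
      using True cycle_type_eq_0_iff[OF B] by (auto simp: cycle_type_empty sym_size_0)
  next
    case False
    then obtain a where a: "a \<in> A" by auto
    define i where "i = least_power f a"
    define A' where "A' = A - cycle_of f a"
    define q where "q = cycle_type f A'"
    define B' where "B' b = B - cycle_of g b" for b
    let ?T = "{b \<in> B. least_power g b = i}"
    have A': "finite A'" "bij_betw f A' A'" "card A' < card A"
      using A a bij_betw_remove_cycle_of unfolding A'_def by auto
    have tA: "cycle_type f A = q + Poly_Mapping.single i 1"
      using cycle_type_remove[OF A a] unfolding q_def A'_def i_def .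
    \<comment> \<open>Both sides lose one part \<open>i\<close>, so the types of the complements
      agree exactly if the original types do.\<close>
    have card: "card (intertwiners f A' g (B' b)) =
        (if cycle_type f A = cycle_type g B then sym_size q else 0)" if b: "b \<in> ?T" for b
    proof -
      have "finite (B' b)" "bij_betw g (B' b) (B' b)"
        using B b bij_betw_remove_cycle_of(1) unfolding B'_def by auto
      moreover have "cycle_type g B = cycle_type g (B' b) + Poly_Mapping.single i 1"
        using cycle_type_remove[OF B, of b] b unfolding B'_def by auto
      ultimately show ?thesis
        using less.hyps[OF A'(3,1,2)] tA unfolding q_def by simp
    qed
    have "card (intertwiners f A g B) = card (SIGMA b:?T. intertwiners f A' g (B' b))"
      unfolding A'_def B'_def i_def
      using bij_betw_same_card[OF bij_betw_intertwiners_remove[OF A a B]] .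
    also have "\<dots> = (\<Sum>b\<in>?T. card (intertwiners f A' g (B' b)))"
    proof (rule card_SigmaI)
      show "finite ?T" using B by simp
      have "finite (A' \<rightarrow>\<^sub>E B' b)" for b
        using A' B unfolding B'_def by (intro finite_PiE) auto
      then show "\<forall>b\<in>?T. finite (intertwiners f A' g (B' b))"
        unfolding intertwiners_def by (auto intro: finite_subset)
    qed
    also have "\<dots> = (if cycle_type f A = cycle_type g B then card ?T * sym_size q else 0)"
      using card by (simp add: sum_constant)
    also have "card ?T = i * Poly_Mapping.lookup (cycle_type g B) i"
      using period_count_eq[OF B] unfolding period_count_def .
    finally have "card (intertwiners f A g B) = (if cycle_type f A = cycle_type g B
        then i * Poly_Mapping.lookup (cycle_type f A) i * sym_size q else 0)"
      by simp
    moreover have "i * Poly_Mapping.lookup (cycle_type f A) i * sym_size q =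
        sym_size (cycle_type f A)"
      unfolding tA sym_size_add_single by (simp add: lookup_add)
    ultimately show ?thesis by presburger
  qed
qed

text \<open>No cycle has length 0, hence \<open>sym_size\<close> of a cycle type is nonzero and the
  number of intertwiners detects equality of types.\<close>

lemma cycle_type_eq_iff:
  assumes "finite A" "bij_betw f A A" "finite B" "bij_betw g B B"
  shows "cycle_type f A = cycle_type g B \<longleftrightarrow> intertwiners f A g B \<noteq> {}"
proof -
  have "sym_size (cycle_type f A) \<noteq> 0"
    using least_power_on(2)[OF assms(1,2)] lookup_cycle_type[OF assms(1), of f 0]
    by (auto simp: sym_size_def in_keys_iff)
  moreover have "finite (intertwiners f A g B)"
    using assms finite_subset[of _ "A \<rightarrow>\<^sub>E B"] by (auto simp: intertwiners_def finite_PiE)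
  ultimately show ?thesis
    using card_intertwiners[OF assms] by (metis card.empty card_0_eq)
qed

section \<open>Cycle types are exactly the partitions\<close>

lemma in_keys_cycle_type:
  assumes "finite A" "i \<in> Poly_Mapping.keys (cycle_type f A)"
  shows "0 < i" "i \<le> card A"
proof -
  have *: "period_count f A i div i \<noteq> 0"
    using assms by (simp add: in_keys_iff lookup_cycle_type)
  then show "0 < i"
    by (metis div_by_0 neq0_conv)
  have "i \<le> period_count f A i"
    using * by (metis div_less not_le)
  also have "\<dots> \<le> card A"
    unfolding period_count_def using assms by (intro card_mono) auto
  finally show "i \<le> card A" .
qed

text \<open>\<open>A\<close> is the disjoint union of its sets of points of fixed period, and a
  period is the size of a nonempty subset of \<open>A\<close>, hence between 1 and
  \<open>card A\<close>.\<close>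

lemma cycle_type_in_partitions:
  assumes "finite A" "bij_betw f A A"
  shows "cycle_type f A \<in> partitions (card A)"
proof -
  have keys: "Poly_Mapping.keys (cycle_type f A) \<subseteq> {1..card A}"
    using in_keys_cycle_type[OF assms(1)] by force
  have "(\<Sum>i=1..card A. i * Poly_Mapping.lookup (cycle_type f A) i) =
      (\<Sum>i=1..card A. card {x \<in> A. least_power f x = i})"
    using period_count_eq[OF assms] by (simp add: period_count_def)
  also have "\<dots> = card (\<Union>i\<in>{1..card A}. {x \<in> A. least_power f x = i})"
    by (rule card_UN_disjoint[symmetric]) (use assms in auto)
  also have "(\<Union>i\<in>{1..card A}. {x \<in> A. least_power f x = i}) = A"
  proof -
    have "least_power f x \<in> {1..card A}" if "x \<in> A" for x
      using least_power_on(2)[OF assms that] card_cycle_of[OF assms that]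
        card_mono[OF assms(1) cycle_of_subset[OF assms(2) that]] by auto
    then show ?thesis by auto
  qed
  finally show ?thesis
    using keys by (simp add: partitions_def)
qed

lemma cycle_type_Un:
  assumes "finite A" "finite B" "bij_betw f A A" "bij_betw f B B" "A \<inter> B = {}"
  shows "cycle_type f (A \<union> B) = cycle_type f A + cycle_type f B"
proof (rule poly_mapping_eqI)
  fix i
  have "{x \<in> A \<union> B. least_power f x = i} =
      {x \<in> A. least_power f x = i} \<union> {x \<in> B. least_power f x = i}" by auto
  then have "period_count f (A \<union> B) i = period_count f A i + period_count f B i"
    unfolding period_count_def using assms by (simp add: card_Un_disjoint disjoint_iff)
  then show "Poly_Mapping.lookup (cycle_type f (A \<union> B)) i =
      Poly_Mapping.lookup (cycle_type f A + cycle_type f B) i"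
    \<comment> \<open>Division by \<open>i\<close> distributes over the sum because \<open>i\<close>
      divides the first count.\<close>
    using assms(1,2) div_plus_div_distrib_dvd_left[OF dvd_period_count[OF assms(1,3)],
        of i "period_count f B i"]
    by (simp only: lookup_cycle_type lookup_add finite_UnI)
qed

lemma cycle_type_cong:
  assumes "\<And>x. x \<in> A \<Longrightarrow> f x = g x" "bij_betw f A A"
  shows "cycle_type f A = cycle_type g A"
proof -
  have "(f ^^ k) x = (g ^^ k) x" if "x \<in> A" for x k
    using funpow_in[OF assms(2) that] assms(1)
    by (induction k) (simp, metis comp_apply funpow.simps(2))
  then have "period_count f A = period_count g A"
    unfolding period_count_def least_power_def by (intro ext arg_cong[where f = card]) auto
  then show ?thesis
    unfolding cycle_type_def by simp
qed

text \<open>Successor modulo \<open>i\<close> on \<open>{..<i}\<close> is an \<open>i\<close>-cycle;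
  it is transported to \<open>A\<close> along a bijection \<open>h\<close>, which then intertwines
  the two maps and so preserves the type.\<close>

lemma single_cycle_exists:
  assumes "finite A" "card A = i" "i > 0"
  obtains f where "bij_betw f A A" "cycle_type f A = Poly_Mapping.single i 1"
proof -
  let ?s = "\<lambda>k. (k + 1) mod i"
  have s: "(?s ^^ m) k = (k + m) mod i" if "k < i" for k m
    using that by (induction m) (auto simp: mod_Suc_eq)
  have s_bij: "bij_betw ?s {..<i} {..<i}"
  \<comment> \<open>Modulo \<open>i\<close>, adding \<open>i - 1\<close> inverts adding 1 without
    leaving the natural numbers.\<close>
  proof (rule bij_betw_byWitness[where f' = "\<lambda>k. (k + (i - 1)) mod i"])
    show "\<forall>k\<in>{..<i}. ((k + 1) mod i + (i - 1)) mod i = k"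
    proof
      fix k assume "k \<in> {..<i}"
      then show "((k + 1) mod i + (i - 1)) mod i = k"
        using assms(3) mod_add_left_eq[of "k + 1" i "i - 1"] by simp
    qed
    show "\<forall>k\<in>{..<i}. ((k + (i - 1)) mod i + 1) mod i = k"
      using assms(3) by (simp add: mod_add_left_eq mod_Suc_eq)
  qed (use assms(3) in auto)
  have *: "least_power ?s k = i" if "k < i" for k
  proof -
    have "(?s ^^ m) k = k \<longleftrightarrow> i dvd m" for m
      using s[OF that, of m] that mod_eq_dvd_iff_nat[of k "k + m" i] by auto
    then have "least_power ?s k = (LEAST m. i dvd m \<and> m > 0)"
      unfolding least_power_def by simp
    also have "\<dots> = i"
      using assms(3) by (intro Least_equality) (auto intro: dvd_imp_le)
    finally show ?thesis .
  qed
  have "period_count ?s {..<i} j = (if j = i then i else 0)" for j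
  proof -
    have "{x \<in> {..<i}. least_power ?s x = j} = (if j = i then {..<i} else {})"
      using * by auto
    then show ?thesis
      unfolding period_count_def by simp
  qed
  then have type: "cycle_type ?s {..<i} = Poly_Mapping.single i 1"
    using assms(3) by (intro poly_mapping_eqI)
      (simp add: lookup_cycle_type lookup_single when_def)
  obtain h where h: "bij_betw h {..<i} A"
    using assms(1,2) using ex_bij_betw_nat_finite[OF assms(1)] by (metis lessThan_atLeast0)
  let ?h' = "inv_into {..<i} h"
  let ?f = "h \<circ> ?s \<circ> ?h'"
  have h': "bij_betw ?h' A {..<i}"
    using bij_betw_inv_into[OF h] .
  have f: "bij_betw ?f A A"
    using bij_betw_trans[OF h' bij_betw_trans[OF s_bij h]] by (simp add: comp_assoc)
  have "restrict h {..<i} \<in> intertwiners ?s {..<i} ?f A"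
    using h s_bij assms(3) unfolding intertwiners_def
    by (auto simp: bij_betw_restrict_eq bij_betw_inv_into_left bij_betw_apply)
  then have "cycle_type ?f A = Poly_Mapping.single i 1"
    using cycle_type_eq_iff[OF _ s_bij assms(1) f] type by auto
  then show ?thesis
    using that f by blast
qed

lemma partitions_remove:
  assumes "p + Poly_Mapping.single i 1 \<in> partitions n"
  shows "1 \<le> i" "i \<le> n" "p \<in> partitions (n - i)"
proof -
  let ?q = "p + Poly_Mapping.single i 1"
  have k: "Poly_Mapping.keys ?q \<subseteq> {1..n}" and
    s: "(\<Sum>j=1..n. j * Poly_Mapping.lookup ?q j) = n"
    using assms unfolding partitions_def by auto
  have "i \<in> Poly_Mapping.keys ?q"
    by (simp add: in_keys_iff lookup_add)
  then show i: "1 \<le> i" "i \<le> n"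
    using k by auto
  have "(\<Sum>j=1..n. j * Poly_Mapping.lookup ?q j) =
      (\<Sum>j=1..n. j * Poly_Mapping.lookup p j) + (\<Sum>j=1..n. if j = i then i else 0)"
    unfolding sum.distrib[symmetric]
    by (rule sum.cong) (auto simp: lookup_add lookup_single)
  also have "(\<Sum>j=1..n. if j = i then i else 0) = i"
    using i by simp
  finally have sp: "(\<Sum>j=1..n. j * Poly_Mapping.lookup p j) = n - i"
    using s by linarith
  have "j \<in> {1..n - i}" if "j \<in> Poly_Mapping.keys p" for j
  proof -
    have jn: "j \<in> {1..n}"
    proof -
      have "j \<in> Poly_Mapping.keys ?q"
        using that by (simp add: in_keys_iff lookup_add)
      then show ?thesis using k by auto
    qed
    \<comment> \<open>The sharper bound \<open>n - i\<close> on the parts of \<open>p\<close> comes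
      from the sum: a part \<open>j\<close> contributes at least \<open>j\<close> to it.\<close>
    have "j \<le> j * Poly_Mapping.lookup p j"
      using that by (simp add: in_keys_iff)
    also have "\<dots> \<le> (\<Sum>j=1..n. j * Poly_Mapping.lookup p j)"
      using jn by (intro member_le_sum) auto
    finally show ?thesis
      using jn sp by auto
  qed
  then have keys: "Poly_Mapping.keys p \<subseteq> {1..n - i}" by auto
  have "(\<Sum>j=1..n - i. j * Poly_Mapping.lookup p j) = (\<Sum>j=1..n. j * Poly_Mapping.lookup p j)"
    using keys by (intro sum.mono_neutral_left) (auto simp: in_keys_iff)
  then show "p \<in> partitions (n - i)"
    using keys sp unfolding partitions_def by auto
qed

lemma partitions_add:
  assumes "p \<in> partitions m" "1 \<le> i"
  shows "p + Poly_Mapping.single i 1 \<in> partitions (m + i)"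
proof -
  let ?q = "p + Poly_Mapping.single i 1"
  have p: "Poly_Mapping.keys p \<subseteq> {1..m}" "(\<Sum>j=1..m. j * Poly_Mapping.lookup p j) = m"
    using assms(1) unfolding partitions_def by auto
  have "(\<Sum>j=1..m + i. j * Poly_Mapping.lookup ?q j) =
      (\<Sum>j=1..m + i. j * Poly_Mapping.lookup p j) + (\<Sum>j=1..m + i. if j = i then i else 0)"
    unfolding sum.distrib[symmetric]
    by (rule sum.cong) (auto simp: lookup_add lookup_single)
  also have "(\<Sum>j=1..m + i. j * Poly_Mapping.lookup p j) = (\<Sum>j=1..m. j * Poly_Mapping.lookup p j)"
    using p(1) by (intro sum.mono_neutral_right) (auto simp: in_keys_iff)
  finally have "(\<Sum>j=1..m + i. j * Poly_Mapping.lookup ?q j) = m + i"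
    using p(2) assms(2) by simp
  moreover have "Poly_Mapping.keys ?q \<subseteq> {1..m + i}"
    using p(1) assms(2) keys_add[of p "Poly_Mapping.single i 1"] by force
  ultimately show ?thesis
    unfolding partitions_def by simp
qed

lemma partitions_0: "partitions 0 = {0}"
  unfolding partitions_def by auto

lemma partitions_obtain_part:
  assumes "p \<in> partitions n" "n > 0"
  obtains q i where "p = q + Poly_Mapping.single i 1"
proof -
  have "p \<noteq> 0"
    using assms unfolding partitions_def by auto
  then obtain i where "Poly_Mapping.lookup p i \<noteq> 0"
    by (metis lookup_zero poly_mapping_eqI)
  then have "p = (p - Poly_Mapping.single i 1) + Poly_Mapping.single i 1"
    by (intro poly_mapping_eqI) (auto simp: lookup_add lookup_minus lookup_single when_def)
  then show ?thesis
    using that by blast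
qed

text \<open>By induction on the size: for a part \<open>i\<close>, place an \<open>i\<close>-cycle
  on a subset \<open>D\<close> with \<open>i\<close> elements and a permutation of the remaining
  type on \<open>A - D\<close>.\<close>

lemma cycle_type_surj:
  assumes "finite A" "p \<in> partitions (card A)"
  shows "\<exists>f. bij_betw f A A \<and> cycle_type f A = p"
  using assms
proof (induction "card A" arbitrary: A p rule: less_induct)
  case less
  show ?case
  proof (cases "A = {}")
    case True
    then show ?thesis
      using less.prems by (auto simp: partitions_0 cycle_type_empty)
  next
    case False
    then have "card A > 0"
      using less.prems by auto
    then obtain q i where p: "p = q + Poly_Mapping.single i 1"
      using partitions_obtain_part less.prems by metis
    note q = partitions_remove[OF less.prems(2)[unfolded p]]
    obtain D where D: "D \<subseteq> A" "card D = i" "finite D"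
      using obtain_subset_with_card_n[OF q(2)] .
    obtain f where f: "bij_betw f D D" "cycle_type f D = Poly_Mapping.single i 1"
      using single_cycle_exists[OF D(3,2)] q(1) by auto
    have cD: "card (A - D) = card A - i"
      using D by (simp add: card_Diff_subset)
    moreover have "card (A - D) < card A"
      using cD q by linarith
    ultimately obtain g where g: "bij_betw g (A - D) (A - D)" "cycle_type g (A - D) = q"
      using less.hyps[of "A - D" q] less.prems(1) q(3) by auto
    define h where "h x = (if x \<in> D then f x else g x)" for x
    have hD: "bij_betw h D D" "cycle_type h D = Poly_Mapping.single i 1"
      using f cycle_type_cong[OF _ f(1), of h] bij_betw_cong[of D h f]
      by (auto simp: h_def)
    have hA: "bij_betw h (A - D) (A - D)" "cycle_type h (A - D) = q"
      using g cycle_type_cong[OF _ g(1), of h] bij_betw_cong[of "A - D" h g]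
      by (auto simp: h_def)
    have "cycle_type h ((A - D) \<union> D) = p"
      using cycle_type_Un[OF _ D(3) hA(1) hD(1)] less.prems(1) hA(2) hD(2) p by auto
    moreover have "bij_betw h ((A - D) \<union> D) ((A - D) \<union> D)"
      using hA(1) hD(1) by (rule bij_betw_combine) auto
    moreover have "(A - D) \<union> D = A"
      using D by auto
    ultimately show ?thesis by auto
  qed
qed

section \<open>Prime powers of permutations\<close>

text \<open>For prime \<open>k\<close> this is what the \<open>k\<close>-th power does to a cycle
  type; on exponent vectors it is the substitution of \<open>X (i div k) ^ k\<close> for
  \<open>X i\<close> at the multiples \<open>i\<close> of \<open>k\<close>.\<close>

definition power_type :: "nat \<Rightarrow> (nat \<Rightarrow>\<^sub>0 nat) \<Rightarrow> (nat \<Rightarrow>\<^sub>0 nat)" where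
  "power_type k p = (\<Sum>i\<in>Poly_Mapping.keys p.
     if k dvd i then Poly_Mapping.single (i div k) (k * Poly_Mapping.lookup p i)
     else Poly_Mapping.single i (Poly_Mapping.lookup p i))"

lemma lookup_power_type:
  assumes "k > 0"
  shows "Poly_Mapping.lookup (power_type k p) j =
    (if k dvd j then 0 else Poly_Mapping.lookup p j) + k * Poly_Mapping.lookup p (k * j)"
proof -
  let ?K = "Poly_Mapping.keys p"
  \<comment> \<open>Only two keys can reach position \<open>j\<close>: \<open>j\<close> itself, if
    not divisible by \<open>k\<close>, and \<open>k * j\<close>, which arrives with multiplicity
    \<open>k\<close>.\<close>
  have "Poly_Mapping.lookup (power_type k p) j =
      (\<Sum>i\<in>?K. (if i = j \<and> \<not> k dvd j then Poly_Mapping.lookup p j else 0) +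
        (if i = k * j then k * Poly_Mapping.lookup p (k * j) else 0))"
    unfolding power_type_def lookup_sum
    using assms by (intro sum.cong) (auto simp: lookup_single when_def)
  also have "\<dots> = (if k dvd j then 0 else Poly_Mapping.lookup p j) +
      k * Poly_Mapping.lookup p (k * j)"
    unfolding sum.distrib by (cases "k dvd j") (auto simp: in_keys_iff)
  finally show ?thesis .
qed

lemma least_power_funpow_prime:
  assumes "finite A" "bij_betw f A A" "x \<in> A" "prime k"
  shows "least_power (f ^^ k) x =
    (if k dvd least_power f x then least_power f x div k else least_power f x)" (is "_ = ?d")
proof -
  let ?i = "least_power f x"
  have i: "?i > 0"
    using least_power_on(2)[OF assms(1-3)] .
  have *: "?i dvd k * m \<longleftrightarrow> ?d dvd m" for m
  proof (cases "k dvd ?i")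
    case True
    then obtain c where "?i = k * c" by auto
    then show ?thesis
      using assms(4) prime_gt_0_nat[of k] by simp
  next
    case False
    then have "coprime ?i k"
      using assms(4) prime_imp_coprime coprime_commute by blast
    then show ?thesis
      using False by (simp add: coprime_dvd_mult_right_iff)
  qed
  have "least_power (f ^^ k) x = (LEAST m. ?d dvd m \<and> m > 0)"
    unfolding least_power_def[of "f ^^ k"] funpow_mult * [symmetric]
      least_power_dvd_on[OF assms(1-3)] by (simp add: mult.commute)
  also have "\<dots> = ?d"
    using i by (intro Least_equality) (auto intro: dvd_imp_le)
  finally show ?thesis .
qed

text \<open>It is enough to count points: period \<open>j\<close> under \<open>f ^^ k\<close> arises
  from period \<open>j\<close> under \<open>f\<close> when \<open>k\<close> does not divide
  \<open>j\<close>, and from period \<open>k * j\<close>.\<close>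

lemma cycle_type_funpow_prime:
  assumes "finite A" "bij_betw f A A" "prime k"
  shows "cycle_type (f ^^ k) A = power_type k (cycle_type f A)"
proof (rule poly_mapping_eqI)
  fix j
  have k: "k > 0"
    using assms(3) prime_gt_0_nat by blast
  have split: "{x \<in> A. least_power (f ^^ k) x = j} =
      (if k dvd j then {} else {x \<in> A. least_power f x = j}) \<union> {x \<in> A. least_power f x = k * j}"
    using least_power_funpow_prime[OF assms(1,2) _ assms(3)] k by (auto split: if_splits)
  have "period_count (f ^^ k) A j =
      (if k dvd j then 0 else period_count f A j) + period_count f A (k * j)"
    unfolding period_count_def split using assms(1) k
    by (subst card_Un_disjoint) (auto simp: dvd_def)
  then have "period_count (f ^^ k) A j = j * Poly_Mapping.lookup (power_type k (cycle_type f A)) j"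
    unfolding lookup_power_type[OF k] period_count_eq[OF assms(1,2)] by (simp add: algebra_simps)
  \<comment> \<open>At \<open>j = 0\<close> the equation between counts says nothing about the
    multiplicity, so this position is treated separately.\<close>
  moreover have "Poly_Mapping.lookup (power_type k (cycle_type f A)) 0 = 0"
    unfolding lookup_power_type[OF k] by (simp add: lookup_cycle_type[OF assms(1)])
  ultimately show "Poly_Mapping.lookup (cycle_type (f ^^ k) A) j =
      Poly_Mapping.lookup (power_type k (cycle_type f A)) j"
    unfolding lookup_cycle_type[OF assms(1)] by (cases "j = 0") auto
qed

section \<open>The coefficients of the generating functions\<close>

text \<open>Multiplication by a monomial shifts exponents by \<open>e\<close>; cancellation in the
  exponent monoid leaves at most one contributing term of the convolution.\<close>

lemma lookup_mult_single:
  fixes q :: "'a::cancel_comm_monoid_add \<Rightarrow>\<^sub>0 'b::semiring_1"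
  shows "Poly_Mapping.lookup (q * Poly_Mapping.single e 1) (p + e) = Poly_Mapping.lookup q p"
    and "(\<nexists>p. r = p + e) \<Longrightarrow> Poly_Mapping.lookup (q * Poly_Mapping.single e 1) r = 0"
proof -
  have *: "(\<Sum>s. Poly_Mapping.lookup (Poly_Mapping.single e (1::'b)) s when r = l + s) =
      (1 when r = l + e)" for r l
  proof -
    have "(\<lambda>s. Poly_Mapping.lookup (Poly_Mapping.single e (1::'b)) s when r = l + s) =
        (\<lambda>s. (1 when r = l + e) when s = e)"
      by (auto simp: fun_eq_iff lookup_single when_def)
    then show ?thesis by (simp only: Sum_any_when_equal)
  qed
  have "(\<lambda>l. Poly_Mapping.lookup q l * (1 when p + e = l + e)) =
      (\<lambda>l. Poly_Mapping.lookup q p when l = p)"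
    by (auto simp: fun_eq_iff when_def)
  then show "Poly_Mapping.lookup (q * Poly_Mapping.single e 1) (p + e) = Poly_Mapping.lookup q p"
    unfolding lookup_mult * by (simp only: Sum_any_when_equal)
  assume "\<nexists>p. r = p + e"
  then have "(\<lambda>l. Poly_Mapping.lookup q l * (1 when r = l + e)) = (\<lambda>l. 0)"
    by (auto simp: fun_eq_iff when_def)
  then show "Poly_Mapping.lookup (q * Poly_Mapping.single e 1) r = 0"
    unfolding lookup_mult * by (simp only: Sum_any.neutral)
qed

lemma lookup_of_nat_mult:
  fixes q :: "'a::comm_monoid_add \<Rightarrow>\<^sub>0 'b::semiring_1"
  shows "Poly_Mapping.lookup (of_nat c * q) p = of_nat c * Poly_Mapping.lookup q p"
  by (induction c) (simp_all add: distrib_right lookup_add)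

lemma Const_mult_of_nat: "of_nat c * Const a = Const (of_nat c * a)"
  unfolding Const_def by (metis add.left_neutral mult_single single_of_nat)

text \<open>Chain rule for the derivative in \<open>t\<close>: the exponential series is its own
  derivative, and the factor \<open>1 / i\<close> in the exponent cancels against the
  \<open>i\<close> brought down. The exponent has constant term 0, as composition requires.\<close>

lemma Z1_deriv: "fps_deriv Z1 = Z1 * Abs_fps (\<lambda>i. X (Suc i))"
proof -
  let ?E = "Abs_fps (\<lambda>k. Const (1 / fact k))"
  let ?F = "Abs_fps (\<lambda>i. if i = 0 then 0 else Const (1 / of_nat i) * X i)"
  have E: "fps_deriv ?E = ?E"
    by (rule fps_ext) (simp add: Const_mult_of_nat del: of_nat_Suc)
  have F: "fps_deriv ?F = Abs_fps (\<lambda>i. X (Suc i))"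
  proof (rule fps_ext)
    fix i
    have "of_nat (Suc i) * (Const (1 / of_nat (Suc i)) * X (Suc i)) = X (Suc i)"
      unfolding mult.assoc[symmetric] Const_mult_of_nat by (simp add: Const_def del: of_nat_Suc)
    then show "fps_nth (fps_deriv ?F) i = fps_nth (Abs_fps (\<lambda>i. X (Suc i))) i"
      by (simp del: of_nat_Suc)
  qed
  have "fps_deriv (fps_compose ?E ?F) = fps_compose (fps_deriv ?E) ?F * fps_deriv ?F"
    by (rule fps_compose_deriv) simp
  then show ?thesis
    unfolding Z1_def exp_series_def E F .
qed

lemma sym_size_pos:
  assumes "p \<in> partitions n"
  shows "sym_size p > 0"
  using assms unfolding sym_size_def partitions_def by (intro prod_pos) auto

lemma Sym_eq_sym_size:
  assumes "p \<in> partitions n"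
  shows "Sym n p = sym_size p"
  using assms sym_size_superset[of "{1..n}" p] unfolding Sym_def partitions_def by auto

text \<open>The differential equation read off at the coefficient of \<open>t ^ n\<close>; the index
  shift \<open>j = i + 1\<close> turns it into a recursion in which one part \<open>j\<close> is
  added.\<close>

lemma Z1_nth_Suc:
  "of_nat (Suc n) * fps_nth Z1 (Suc n) = (\<Sum>j=1..Suc n. fps_nth Z1 (Suc n - j) * X j)"
proof -
  have "of_nat (Suc n) * fps_nth Z1 (Suc n) = fps_nth (Abs_fps (\<lambda>i. X (Suc i)) * Z1) n"
    unfolding mult.commute[of _ Z1] Z1_deriv[symmetric] by simp
  also have "\<dots> = (\<Sum>i=0..n. fps_nth Z1 (n - i) * X (Suc i))"
    unfolding fps_mult_nth fps_nth_Abs_fps by (rule sum.cong) (simp_all only: mult.commute)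
  also have "\<dots> = (\<Sum>j=1..Suc n. fps_nth Z1 (Suc n - j) * X j)"
    using sum.shift_bounds_cl_Suc_ivl[of "\<lambda>j. fps_nth Z1 (Suc n - j) * X j" 0 n] by simp
  finally show ?thesis .
qed

lemma partitions_remove_iff:
  assumes "1 \<le> j" "j \<le> n"
  shows "q \<in> partitions (n - j) \<longleftrightarrow> q + Poly_Mapping.single j 1 \<in> partitions n"
  using partitions_remove(3)[of q j n] partitions_add[of q "n - j" j] assms by auto

text \<open>In the recursion, \<open>p\<close> arises from the smaller partition \<open>q\<close>
  lacking one part \<open>j\<close>, and \<open>1 / sym_size q\<close> is \<open>j\<close> times the
  multiplicity of \<open>j\<close> over \<open>sym_size p\<close>. Summed over \<open>j\<close> the
  numerators give \<open>n\<close>, which cancels the factor \<open>n\<close> on the left.\<close>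

theorem Coeff_Z1:
  "Poly_Mapping.lookup (fps_nth Z1 n) p = (if p \<in> partitions n then 1 / of_nat (sym_size p) else 0)"
proof (induction n arbitrary: p rule: less_induct)
  case (less n)
  show ?case
  proof (cases n)
    case 0
    have "fps_nth Z1 0 = 1"
      unfolding Z1_def exp_series_def by (simp add: Const_def)
    then show ?thesis
      using 0 by (auto simp: partitions_0 sym_size_0 lookup_one)
  next
    case (Suc m)
    have step: "Poly_Mapping.lookup (fps_nth Z1 (n - j) * X j) p =
        (if p \<in> partitions n then of_nat (j * Poly_Mapping.lookup p j) / of_nat (sym_size p) else 0)"
      if j: "j \<in> {1..n}" for j
    proof (cases "\<exists>q. p = q + Poly_Mapping.single j 1")
      case True
      then obtain q where q: "p = q + Poly_Mapping.single j 1" by auto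
      have "Poly_Mapping.lookup (fps_nth Z1 (n - j) * X j) p = Poly_Mapping.lookup (fps_nth Z1 (n - j)) q"
        unfolding X_def q by (rule lookup_mult_single(1))
      also have "\<dots> = (if p \<in> partitions n then 1 / of_nat (sym_size q) else 0)"
        using less[of "n - j" q] j partitions_remove_iff[of j n q] unfolding q by auto
      also have "1 / of_nat (sym_size q) =
          (of_nat (j * Poly_Mapping.lookup p j) / of_nat (sym_size p) :: rat)"
      proof -
        have "sym_size p = j * Poly_Mapping.lookup p j * sym_size q"
          unfolding q sym_size_add_single by (simp add: lookup_add)
        moreover have "j * Poly_Mapping.lookup p j \<noteq> 0"
          using j unfolding q by (simp add: lookup_add)
        ultimately show ?thesis
          by (simp del: of_nat_mult add: of_nat_mult[of _ "sym_size q"])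
      qed
      finally show ?thesis .
    next
      case False
      then have "Poly_Mapping.lookup (fps_nth Z1 (n - j) * X j) p = 0"
        unfolding X_def using lookup_mult_single(2) by blast
      \<comment> \<open>If \<open>p\<close> has no part \<open>j\<close>, the claimed value is 0 as
        well, so one formula covers both cases.\<close>
      moreover have "Poly_Mapping.lookup p j = 0"
      proof (rule ccontr)
        assume "Poly_Mapping.lookup p j \<noteq> 0"
        then have "p = (p - Poly_Mapping.single j 1) + Poly_Mapping.single j 1"
          by (intro poly_mapping_eqI) (auto simp: lookup_add lookup_minus lookup_single when_def)
        with False show False by blast
      qed
      ultimately show ?thesis by simp
    qed
    have "of_nat n * Poly_Mapping.lookup (fps_nth Z1 n) p =
        (\<Sum>j=1..n. Poly_Mapping.lookup (fps_nth Z1 (n - j) * X j) p)"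
      using arg_cong[OF Z1_nth_Suc[of m], of "\<lambda>q. Poly_Mapping.lookup q p"]
      unfolding Suc lookup_of_nat_mult lookup_sum .
    also have "\<dots> = (\<Sum>j=1..n. if p \<in> partitions n
        then of_nat (j * Poly_Mapping.lookup p j) / of_nat (sym_size p) else 0)"
      using step by (rule sum.cong[OF refl])
    also have "\<dots> = (if p \<in> partitions n then of_nat n / of_nat (sym_size p) else 0)"
    proof (cases "p \<in> partitions n")
      case True
      then have "(\<Sum>j=1..n. j * Poly_Mapping.lookup p j) = n"
        unfolding partitions_def by simp
      from arg_cong[OF this, of "\<lambda>a. of_nat a / (of_nat (sym_size p) :: rat)"] show ?thesis
        unfolding of_nat_sum sum_divide_distrib using True by (simp only: if_True)
    qed simp
    finally have "of_nat n * Poly_Mapping.lookup (fps_nth Z1 n) p =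
        of_nat n * (if p \<in> partitions n then 1 / of_nat (sym_size p) else 0)"
      by simp
    then show ?thesis
      using Suc by (simp del: of_nat_Suc)
  qed
qed

text \<open>No coefficient at a partition vanishes, so the substitution becomes a sum over all
  partitions. Finiteness of \<open>partitions n\<close> also comes from this.\<close>

lemma keys_Z1: "Poly_Mapping.keys (fps_nth Z1 n) = partitions n"
  using sym_size_pos[of _ n] by (auto simp: in_keys_iff Coeff_Z1 split: if_splits)

lemma finite_partitions: "finite (partitions n)"
  using keys_Z1[of n] by (metis finite_keys)

lemma X_power: "X i ^ e = Poly_Mapping.single (Poly_Mapping.single i e) 1"
  by (induction e) (simp_all add: X_def mult_single single_add[symmetric])

lemma single_power:
  "(Poly_Mapping.single (Poly_Mapping.single i a) 1 :: xpoly) ^ b =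
    Poly_Mapping.single (Poly_Mapping.single i (a * b)) 1"
  by (metis X_power power_mult)

lemma prod_single_one:
  "(\<Prod>i\<in>S. Poly_Mapping.single (g i) 1) = Poly_Mapping.single (\<Sum>i\<in>S. g i) (1::'b::comm_semiring_1)"
  by (induction S rule: infinite_finite_induct) (simp_all add: mult_single)

text \<open>The substitution sends the monomial with exponent \<open>m\<close> to the one with
  exponent \<open>power_type k m\<close>, so several monomials may merge and their coefficients add
  up.\<close>

theorem Coeff_subst_Z1:
  "Coeff (subst_series (\<lambda>i. if k dvd i then X (i div k) ^ k else X i) Z1) n p =
    (\<Sum>m\<in>{m \<in> partitions n. power_type k m = p}. 1 / of_nat (sym_size m))"
proof -
  let ?f = "\<lambda>i. if k dvd i then X (i div k) ^ k else X i"
  have monom: "(\<Prod>i\<in>Poly_Mapping.keys m. ?f i ^ Poly_Mapping.lookup m i) =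
      Poly_Mapping.single (power_type k m) 1" for m
    unfolding power_type_def prod_single_one[symmetric]
    by (rule prod.cong) (simp_all add: X_power single_power mult.commute)
  have "Coeff (subst_series ?f Z1) n p = (\<Sum>m\<in>partitions n. Poly_Mapping.lookup
      (Const (Poly_Mapping.lookup (fps_nth Z1 n) m) * Poly_Mapping.single (power_type k m) 1) p)"
    unfolding Coeff_def subst_series_def subst_poly_def by (simp add: keys_Z1 monom lookup_sum)
  also have "\<dots> = (\<Sum>m\<in>partitions n. if power_type k m = p then 1 / of_nat (sym_size m) else 0)"
    by (rule sum.cong) (auto simp: Const_def mult_single Coeff_Z1 lookup_single when_def)
  finally show ?thesis
    using finite_partitions[of n] by (simp add: sum.inter_filter)
qed

section \<open>The three sums over the symmetric group\<close>

context
  fixes n :: nat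
begin

lemma finite_Sn: "finite (Sn n)"
  unfolding Sn_def by (simp add: finite_permutations)

lemma card_Sn: "card (Sn n) = fact n"
  unfolding Sn_def by (simp add: card_permutations)

lemma Sn_closed [simp]:
  shows "id \<in> Sn n"
    and "\<sigma> \<in> Sn n \<Longrightarrow> inv \<sigma> \<in> Sn n"
    and "\<sigma> \<in> Sn n \<Longrightarrow> \<tau> \<in> Sn n \<Longrightarrow> \<sigma> \<circ> \<tau> \<in> Sn n"
  unfolding Sn_def by (auto simp: permutes_id permutes_inv permutes_compose)

lemma Sn_bij: "\<sigma> \<in> Sn n \<Longrightarrow> bij \<sigma>"
  unfolding Sn_def by (auto dest: permutes_bij)

text \<open>The third and fourth equations cancel at the head of a right-nested composition, so that
  simplification with \<open>comp_assoc\<close> reduces words in permutations and their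
  inverses.\<close>

lemma Sn_cancel [simp]:
  assumes "\<sigma> \<in> Sn n"
  shows "inv \<sigma> \<circ> \<sigma> = id" "\<sigma> \<circ> inv \<sigma> = id"
    and "inv \<sigma> \<circ> (\<sigma> \<circ> \<tau>) = \<tau>" "\<sigma> \<circ> (inv \<sigma> \<circ> \<tau>) = \<tau>"
    and "inv (inv \<sigma>) = \<sigma>"
  using assms permutes_inv_o[of \<sigma>] unfolding Sn_def
  by (auto simp: comp_assoc[symmetric] permutes_inv_inv)

lemma Sn_funpow: "\<sigma> \<in> Sn n \<Longrightarrow> \<sigma> ^^ k \<in> Sn n"
  by (induction k) simp_all

lemma Sn_left_cancel:
  assumes "\<sigma> \<in> Sn n"
  shows "\<sigma> \<circ> \<tau> = \<sigma> \<circ> \<tau>' \<longleftrightarrow> \<tau> = \<tau>'"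
  using Sn_cancel(3)[OF assms] by metis

lemma Sn_right_cancel:
  assumes "\<sigma> \<in> Sn n"
  shows "\<tau> \<circ> \<sigma> = \<tau>' \<circ> \<sigma> \<longleftrightarrow> \<tau> = \<tau>'"
  using Sn_cancel(2)[OF assms] by (metis comp_assoc comp_id)

lemma Sn_bij_betw: "\<sigma> \<in> Sn n \<Longrightarrow> bij_betw \<sigma> {1..n} {1..n}"
  unfolding Sn_def by (auto dest: permutes_imp_bij)

section \<open>Centralizers, conjugacy classes and roots in the symmetric group\<close>

definition perm_type :: "(nat \<Rightarrow> nat) \<Rightarrow> (nat \<Rightarrow>\<^sub>0 nat)" where
  "perm_type \<gamma> = cycle_type \<gamma> {1..n}"

lemma perm_type_in_partitions: "\<gamma> \<in> Sn n \<Longrightarrow> perm_type \<gamma> \<in> partitions n"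
  using cycle_type_in_partitions[of "{1..n}" \<gamma>] Sn_bij_betw unfolding perm_type_def by simp

text \<open>A permutation of \<open>{1..n}\<close> is the identity elsewhere, so restriction loses
  nothing and turns conjugators into intertwiners. The case \<delta> = \<gamma> gives the order of
  the centralizer.\<close>

lemma card_conjugators:
  assumes "\<gamma> \<in> Sn n" "\<delta> \<in> Sn n"
  shows "card {\<sigma> \<in> Sn n. \<sigma> \<circ> \<gamma> = \<delta> \<circ> \<sigma>} =
    (if perm_type \<gamma> = perm_type \<delta> then sym_size (perm_type \<gamma>) else 0)"
proof -
  let ?A = "{1..n}"
  let ?ext = "\<lambda>h x. if x \<in> ?A then h x else x"
  have out: "\<sigma> x = x" if "\<sigma> \<in> Sn n" "x \<notin> ?A" for \<sigma> x
    using that permutes_not_in unfolding Sn_def by fastforce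
  have inA: "\<sigma> x \<in> ?A" if "\<sigma> \<in> Sn n" "x \<in> ?A" for \<sigma> x
    using that Sn_bij_betw bij_betw_apply by metis
  have "bij_betw (\<lambda>\<sigma>. restrict \<sigma> ?A) {\<sigma> \<in> Sn n. \<sigma> \<circ> \<gamma> = \<delta> \<circ> \<sigma>} (intertwiners \<gamma> ?A \<delta> ?A)"
  proof (rule bij_betw_byWitness[where f' = ?ext])
    show "\<forall>\<sigma>\<in>{\<sigma> \<in> Sn n. \<sigma> \<circ> \<gamma> = \<delta> \<circ> \<sigma>}. ?ext (restrict \<sigma> ?A) = \<sigma>"
    proof (intro ballI ext)
      fix \<sigma> x assume "\<sigma> \<in> {\<sigma> \<in> Sn n. \<sigma> \<circ> \<gamma> = \<delta> \<circ> \<sigma>}"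
      then have "\<sigma> \<in> Sn n" by simp
      then show "?ext (restrict \<sigma> ?A) x = \<sigma> x"
        using out[of \<sigma> x] by (cases "x \<in> ?A") simp_all
    qed
    show "\<forall>h\<in>intertwiners \<gamma> ?A \<delta> ?A. restrict (?ext h) ?A = h"
    proof (intro ballI ext)
      fix h x assume "h \<in> intertwiners \<gamma> ?A \<delta> ?A"
      then have "h \<in> ?A \<rightarrow>\<^sub>E ?A"
        unfolding intertwiners_def by simp
      then show "restrict (?ext h) ?A x = h x"
        using PiE_arb[of h ?A _ x] by (cases "x \<in> ?A") simp_all
    qed
    show "(\<lambda>\<sigma>. restrict \<sigma> ?A) ` {\<sigma> \<in> Sn n. \<sigma> \<circ> \<gamma> = \<delta> \<circ> \<sigma>} \<subseteq> intertwiners \<gamma> ?A \<delta> ?A"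
    proof
      fix h assume "h \<in> (\<lambda>\<sigma>. restrict \<sigma> ?A) ` {\<sigma> \<in> Sn n. \<sigma> \<circ> \<gamma> = \<delta> \<circ> \<sigma>}"
      then obtain \<sigma> where \<sigma>: "h = restrict \<sigma> ?A" "\<sigma> \<in> Sn n" "\<sigma> \<circ> \<gamma> = \<delta> \<circ> \<sigma>" by auto
      then have "bij_betw h ?A ?A"
        using Sn_bij_betw by (simp add: bij_betw_restrict_eq)
      moreover have "h (\<gamma> x) = \<delta> (h x)" if "x \<in> ?A" for x
        using \<sigma>(3) inA[OF assms(1) that] that unfolding \<sigma>(1) by (metis comp_apply restrict_apply')
      moreover have "h \<in> ?A \<rightarrow>\<^sub>E ?A"
        using inA[OF \<sigma>(2)] unfolding \<sigma>(1) by (intro restrict_PiE_iff[THEN iffD2]) blast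
      ultimately show "h \<in> intertwiners \<gamma> ?A \<delta> ?A"
        unfolding intertwiners_def by blast
    qed
    show "?ext ` intertwiners \<gamma> ?A \<delta> ?A \<subseteq> {\<sigma> \<in> Sn n. \<sigma> \<circ> \<gamma> = \<delta> \<circ> \<sigma>}"
    proof
      fix \<sigma> assume "\<sigma> \<in> ?ext ` intertwiners \<gamma> ?A \<delta> ?A"
      then obtain h where \<sigma>: "\<sigma> = ?ext h" and h: "bij_betw h ?A ?A" "\<forall>x\<in>?A. h (\<gamma> x) = \<delta> (h x)"
        unfolding intertwiners_def by auto
      have "\<sigma> \<in> Sn n"
        unfolding Sn_def \<sigma> using restrict_permutes[OF h(1)] by simp
      moreover have "\<sigma> (\<gamma> x) = \<delta> (\<sigma> x)" for x
      proof (cases "x \<in> ?A")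
        case True
        then show ?thesis
          using h(2) inA[OF assms(1) True] unfolding \<sigma> by simp
      next
        case False
        then have "\<gamma> x = x" "\<delta> x = x"
          using out assms by auto
        then show ?thesis
          using False unfolding \<sigma> by (simp only: if_False)
      qed
      ultimately show "\<sigma> \<in> {\<sigma> \<in> Sn n. \<sigma> \<circ> \<gamma> = \<delta> \<circ> \<sigma>}"
        by (simp add: fun_eq_iff)
    qed
  qed
  then show ?thesis
    unfolding perm_type_def
    using bij_betw_same_card card_intertwiners[OF _ Sn_bij_betw[OF assms(1)] _ Sn_bij_betw[OF assms(2)]]
    by fastforce
qed

lemma card_eq_sum_of_bool:
  assumes "finite A"
  shows "of_nat (card {x \<in> A. P x}) = (\<Sum>x\<in>A. of_bool (P x) :: 'a::semiring_1)"
  using assms by (simp add: of_bool_def sum.inter_filter[symmetric])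

text \<open>Fix \<gamma> of type \<open>p\<close> and count the pairs with
  \<open>\<sigma> \<circ> \<gamma> = \<delta> \<circ> \<sigma>\<close> twice: each \<sigma>
  determines \<delta> as a conjugate of \<gamma>, while each \<delta> of type \<open>p\<close> has
  \<open>sym_size p\<close> conjugators.\<close>

lemma card_perm_type:
  assumes "p \<in> partitions n"
  shows "card {\<gamma> \<in> Sn n. perm_type \<gamma> = p} * sym_size p = fact n"
proof -
  obtain f where f: "bij_betw f {1..n} {1..n}" "cycle_type f {1..n} = p"
    using cycle_type_surj[of "{1..n}" p] assms by auto
  define \<gamma> where "\<gamma> x = (if x \<in> {1..n} then f x else x)" for x
  have \<gamma>: "\<gamma> \<in> Sn n"
    using restrict_permutes[OF f(1)] unfolding Sn_def \<gamma>_def by simp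
  have type: "perm_type \<gamma> = p"
    unfolding perm_type_def using f cycle_type_cong[of "{1..n}" f \<gamma>] by (auto simp: \<gamma>_def)
  have one: "card {\<delta> \<in> Sn n. \<sigma> \<circ> \<gamma> = \<delta> \<circ> \<sigma>} = 1" if \<sigma>: "\<sigma> \<in> Sn n" for \<sigma>
  proof -
    have "\<sigma> \<circ> \<gamma> = \<delta> \<circ> \<sigma> \<longleftrightarrow> \<delta> = \<sigma> \<circ> \<gamma> \<circ> inv \<sigma>" for \<delta>
      using \<sigma> by (metis Sn_cancel(1,2) comp_assoc comp_id)
    then have "{\<delta> \<in> Sn n. \<sigma> \<circ> \<gamma> = \<delta> \<circ> \<sigma>} = {\<sigma> \<circ> \<gamma> \<circ> inv \<sigma>}"
      using \<sigma> \<gamma> by auto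
    then show ?thesis by simp
  qed
  have "fact n = (\<Sum>\<sigma>\<in>Sn n. card {\<delta> \<in> Sn n. \<sigma> \<circ> \<gamma> = \<delta> \<circ> \<sigma>})"
    using one card_Sn by simp
  also have "\<dots> = (\<Sum>\<sigma>\<in>Sn n. \<Sum>\<delta>\<in>Sn n. of_bool (\<sigma> \<circ> \<gamma> = \<delta> \<circ> \<sigma>))"
    using card_eq_sum_of_bool[OF finite_Sn, where 'a = nat] by simp
  also have "\<dots> = (\<Sum>\<delta>\<in>Sn n. card {\<sigma> \<in> Sn n. \<sigma> \<circ> \<gamma> = \<delta> \<circ> \<sigma>})"
    using card_eq_sum_of_bool[OF finite_Sn, where 'a = nat] by (subst sum.swap) simp
  also have "\<dots> = (\<Sum>\<delta>\<in>Sn n. if perm_type \<delta> = p then sym_size p else 0)"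
    using card_conjugators[OF \<gamma>] type by (intro sum.cong) auto
  also have "\<dots> = card {\<gamma> \<in> Sn n. perm_type \<gamma> = p} * sym_size p"
    using finite_Sn by (simp add: sum.inter_filter[symmetric])
  finally show ?thesis ..
qed

text \<open>The map \<open>t\<close> is arbitrary because the sums are grouped by the type of
  \<gamma> as well as by the type of a power of \<gamma>.\<close>

lemma sum_by_type:
  fixes F :: "(nat \<Rightarrow>\<^sub>0 nat) \<Rightarrow> rat"
  assumes "\<And>\<gamma>. \<gamma> \<in> Sn n \<Longrightarrow> t \<gamma> \<in> partitions n"
  shows "(\<Sum>\<gamma>\<in>Sn n. F (t \<gamma>)) = (\<Sum>p\<in>partitions n. of_nat (card {\<gamma> \<in> Sn n. t \<gamma> = p}) * F p)"
proof -
  have "(\<Sum>\<gamma>\<in>Sn n. F (t \<gamma>)) = (\<Sum>p\<in>partitions n. \<Sum>\<gamma>\<in>{\<gamma> \<in> Sn n. t \<gamma> = p}. F (t \<gamma>))"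
    by (rule sum.group[symmetric, OF finite_Sn finite_partitions]) (use assms in auto)
  then show ?thesis by simp
qed

lemma perm_type_funpow_prime:
  assumes "\<gamma> \<in> Sn n" "prime k"
  shows "perm_type (\<gamma> ^^ k) = power_type k (perm_type \<gamma>)"
  using cycle_type_funpow_prime[OF _ Sn_bij_betw[OF assms(1)] assms(2)]
  unfolding perm_type_def by simp

text \<open>Grouping by the type \<open>m\<close> of \<gamma> counts the class sizes
  \<open>fact n / sym_size m\<close> over all \<open>m\<close> with
  \<open>power_type k m = p\<close>; these are \<open>fact n\<close> times the terms of the
  substituted coefficient.\<close>

lemma Coeff_power_type:
  assumes "prime k" "p \<in> partitions n"
  shows "Coeff (subst_series (\<lambda>i. if k dvd i then X (i div k) ^ k else X i) Z1) n p =
    of_nat (card {\<gamma> \<in> Sn n. perm_type (\<gamma> ^^ k) = p}) / fact n"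
proof -
  have "of_nat (card {\<gamma> \<in> Sn n. perm_type (\<gamma> ^^ k) = p}) =
      (\<Sum>\<gamma>\<in>Sn n. of_bool (power_type k (perm_type \<gamma>) = p) :: rat)"
    unfolding card_eq_sum_of_bool[OF finite_Sn]
    using perm_type_funpow_prime[OF _ assms(1)] by (intro sum.cong) auto
  also have "\<dots> = (\<Sum>m\<in>partitions n. of_nat (card {\<gamma> \<in> Sn n. perm_type \<gamma> = m}) *
      of_bool (power_type k m = p))"
    using sum_by_type[OF perm_type_in_partitions] .
  also have "\<dots> = (\<Sum>m\<in>{m \<in> partitions n. power_type k m = p}.
      of_nat (card {\<gamma> \<in> Sn n. perm_type \<gamma> = m}))"
    using finite_partitions by (simp add: of_bool_def sum.inter_filter if_distrib cong: if_cong)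
  also have "\<dots> = (\<Sum>m\<in>{m \<in> partitions n. power_type k m = p}. fact n / of_nat (sym_size m))"
  proof (rule sum.cong)
    fix m assume "m \<in> {m \<in> partitions n. power_type k m = p}"
    then have m: "m \<in> partitions n" by simp
    have "of_nat (card {\<gamma> \<in> Sn n. perm_type \<gamma> = m}) * of_nat (sym_size m) = (fact n :: rat)"
      using arg_cong[OF card_perm_type[OF m], of "of_nat :: nat \<Rightarrow> rat"] by simp
    then show "of_nat (card {\<gamma> \<in> Sn n. perm_type \<gamma> = m}) = (fact n / of_nat (sym_size m) :: rat)"
      using sym_size_pos[OF m] by (simp add: eq_divide_eq)
  qed simp
  also have "\<dots> = fact n * Coeff (subst_series (\<lambda>i. if k dvd i then X (i div k) ^ k else X i) Z1) n p"
    unfolding Coeff_subst_Z1 sum_distrib_left by simp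
  finally show ?thesis by simp
qed

section \<open>Delta sums as counts, and their evaluation by cycle type\<close>

lemma delta_commutator:
  assumes "\<gamma> \<in> Sn n" "\<sigma> \<in> Sn n"
  shows "delta (inv \<gamma> \<circ> \<sigma> \<circ> \<gamma> \<circ> inv \<sigma>) = of_bool (\<sigma> \<circ> \<gamma> = \<gamma> \<circ> \<sigma>)"
    and "delta (\<gamma> \<circ> \<sigma> \<circ> inv \<gamma> \<circ> inv \<sigma>) = of_bool (\<sigma> \<circ> \<gamma> = \<gamma> \<circ> \<sigma>)"
proof -
  have "inv \<gamma> \<circ> \<sigma> \<circ> \<gamma> \<circ> inv \<sigma> = id \<longleftrightarrow> \<sigma> \<circ> \<gamma> = \<gamma> \<circ> \<sigma>"
    using Sn_left_cancel[of \<gamma> "inv \<gamma> \<circ> \<sigma> \<circ> \<gamma> \<circ> inv \<sigma>" id]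
      Sn_right_cancel[of \<sigma> "\<sigma> \<circ> \<gamma> \<circ> inv \<sigma>" \<gamma>] assms
    by (simp add: comp_assoc)
  then show "delta (inv \<gamma> \<circ> \<sigma> \<circ> \<gamma> \<circ> inv \<sigma>) = of_bool (\<sigma> \<circ> \<gamma> = \<gamma> \<circ> \<sigma>)"
    unfolding delta_def by simp
  have "\<gamma> \<circ> \<sigma> \<circ> inv \<gamma> \<circ> inv \<sigma> = id \<longleftrightarrow> \<gamma> \<circ> \<sigma> = \<sigma> \<circ> \<gamma>"
    using Sn_right_cancel[of "\<sigma> \<circ> \<gamma>" "\<gamma> \<circ> \<sigma> \<circ> inv \<gamma> \<circ> inv \<sigma>" id] assms
    by (simp add: comp_assoc)
  then show "delta (\<gamma> \<circ> \<sigma> \<circ> inv \<gamma> \<circ> inv \<sigma>) = of_bool (\<sigma> \<circ> \<gamma> = \<gamma> \<circ> \<sigma>)"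
    unfolding delta_def by auto
qed

abbreviation centralizer :: "(nat \<Rightarrow> nat) \<Rightarrow> (nat \<Rightarrow> nat) set" where
  "centralizer \<gamma> \<equiv> {\<sigma> \<in> Sn n. \<sigma> \<circ> \<gamma> = \<gamma> \<circ> \<sigma>}"

text \<open>For fixed \<gamma> the two delta factors constrain \<sigma> and \<sigma>' independently,
  so the inner double sum is a square.\<close>

lemma S3_111_eq_centralizers:
  "S3_111 n = of_nat (\<Sum>\<gamma>\<in>Sn n. card (centralizer \<gamma>) ^ 2) / fact n"
proof -
  have "(\<Sum>\<gamma>\<in>Sn n. \<Sum>\<sigma>\<in>Sn n. \<Sum>\<sigma>'\<in>Sn n.
      delta (inv \<gamma> \<circ> \<sigma> \<circ> \<gamma> \<circ> inv \<sigma>) * delta (inv \<gamma> \<circ> \<sigma>' \<circ> \<gamma> \<circ> inv \<sigma>')) =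
      of_nat (\<Sum>\<gamma>\<in>Sn n. card (centralizer \<gamma>) ^ 2)"
    unfolding of_nat_sum power2_eq_square of_nat_mult card_eq_sum_of_bool[OF finite_Sn] sum_product
    by (intro sum.cong refl) (simp only: delta_commutator(1))
  then show ?thesis
    unfolding S3_111_def by simp
qed

lemma S3_21_eq_centralizers:
  "S3_21 n = of_nat (\<Sum>\<gamma>\<in>Sn n. card (centralizer (\<gamma> ^^ 2))) / fact n"
  unfolding S3_21_def of_nat_sum card_eq_sum_of_bool[OF finite_Sn]
  by (simp add: delta_commutator(2) Sn_funpow cong: sum.cong)

lemma S3_3_eq_card:
  "S3_3 n = of_nat (\<Sum>\<gamma>\<in>Sn n. card {\<sigma> \<in> Sn n. (\<gamma> ^^ 3) \<circ> (\<sigma> ^^ 3) = id}) / fact n"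
  unfolding S3_3_def of_nat_sum card_eq_sum_of_bool[OF finite_Sn]
  by (simp add: delta_def of_bool_def)

text \<open>Each of the \<open>fact n / Sym n p\<close> permutations of type \<open>p\<close>
  contributes the square of its centralizer order \<open>Sym n p\<close>.\<close>

lemma S3_111_eq_Sym: "S3_111 n = (\<Sum>p\<in>partitions n. of_nat (Sym n p))"
proof -
  have "of_nat (\<Sum>\<gamma>\<in>Sn n. card (centralizer \<gamma>) ^ 2) =
      (\<Sum>\<gamma>\<in>Sn n. (of_nat (sym_size (perm_type \<gamma>)))\<^sup>2 :: rat)"
    unfolding of_nat_sum by (rule sum.cong) (simp_all add: card_conjugators)
  also have "\<dots> = (\<Sum>p\<in>partitions n.
      of_nat (card {\<gamma> \<in> Sn n. perm_type \<gamma> = p}) * (of_nat (sym_size p))\<^sup>2)"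
    using sum_by_type[OF perm_type_in_partitions] .
  also have "\<dots> = (\<Sum>p\<in>partitions n. fact n * of_nat (Sym n p))"
  proof (rule sum.cong)
    fix p assume p: "p \<in> partitions n"
    have "of_nat (card {\<gamma> \<in> Sn n. perm_type \<gamma> = p}) * of_nat (sym_size p) = (fact n :: rat)"
      using arg_cong[OF card_perm_type[OF p], of "of_nat :: nat \<Rightarrow> rat"] by simp
    then show "of_nat (card {\<gamma> \<in> Sn n. perm_type \<gamma> = p}) * (of_nat (sym_size p))\<^sup>2 =
        (fact n * of_nat (Sym n p) :: rat)"
      unfolding Sym_eq_sym_size[OF p] power2_eq_square mult.assoc[symmetric] by simp
  qed simp
  finally show ?thesis
    unfolding S3_111_eq_centralizers sum_distrib_left[symmetric] by simp
qed

text \<open>The sum is grouped by the type \<open>p\<close> of the square of \<gamma>: the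
  centralizer of the square has order \<open>Sym n p\<close>, and \<open>Coeff Z2 n p\<close> is the
  proportion of such \<gamma>.\<close>

lemma S3_21_eq_Coeff: "S3_21 n = (\<Sum>p\<in>partitions n. Coeff Z2 n p * of_nat (Sym n p))"
proof -
  have "of_nat (\<Sum>\<gamma>\<in>Sn n. card (centralizer (\<gamma> ^^ 2))) =
      (\<Sum>\<gamma>\<in>Sn n. of_nat (sym_size (perm_type (\<gamma> ^^ 2))) :: rat)"
    unfolding of_nat_sum by (rule sum.cong) (simp_all add: card_conjugators Sn_funpow)
  also have "\<dots> = (\<Sum>p\<in>partitions n.
      of_nat (card {\<gamma> \<in> Sn n. perm_type (\<gamma> ^^ 2) = p}) * of_nat (sym_size p))"
    by (rule sum_by_type) (simp add: perm_type_in_partitions Sn_funpow)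
  finally show ?thesis
    unfolding S3_21_eq_centralizers sum_divide_distrib
    by (simp add: Z2_def Coeff_power_type Sym_eq_sym_size sum_divide_distrib cong: sum.cong)
qed

lemma Sn_funpow_conj:
  assumes "h \<in> Sn n" "\<gamma> \<in> Sn n"
  shows "(h \<circ> \<gamma> \<circ> inv h) ^^ k = h \<circ> \<gamma> ^^ k \<circ> inv h"
  using assms by (induction k) (simp_all add: comp_assoc)

text \<open>Replacing \<sigma> by its inverse moves the second cube to the other side, and inversion
  permutes \<open>Sn n\<close>.\<close>

lemma sum_cube_solutions:
  "(\<Sum>\<gamma>\<in>Sn n. card {\<sigma> \<in> Sn n. (\<gamma> ^^ 3) \<circ> (\<sigma> ^^ 3) = id}) =
    (\<Sum>\<gamma>\<in>Sn n. card {\<sigma> \<in> Sn n. \<gamma> ^^ 3 = \<sigma> ^^ 3})"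
proof (rule sum.cong)
  fix \<gamma> assume \<gamma>: "\<gamma> \<in> Sn n"
  have "\<gamma> ^^ 3 \<circ> \<sigma> ^^ 3 = id \<longleftrightarrow> \<gamma> ^^ 3 = (inv \<sigma>) ^^ 3" if "\<sigma> \<in> Sn n" for \<sigma>
    using Sn_right_cancel[OF Sn_funpow[OF that, of 3], of "\<gamma> ^^ 3" "inv (\<sigma> ^^ 3)"]
    by (simp add: Sn_funpow that inv_fn[OF Sn_bij[OF that], symmetric])
  then have "bij_betw inv {\<sigma> \<in> Sn n. (\<gamma> ^^ 3) \<circ> (\<sigma> ^^ 3) = id} {\<sigma> \<in> Sn n. \<gamma> ^^ 3 = \<sigma> ^^ 3}"
    by (intro bij_betw_byWitness[where f' = inv]) auto
  then show "card {\<sigma> \<in> Sn n. (\<gamma> ^^ 3) \<circ> (\<sigma> ^^ 3) = id} = card {\<sigma> \<in> Sn n. \<gamma> ^^ 3 = \<sigma> ^^ 3}"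
    by (rule bij_betw_same_card)
qed simp

text \<open>Conjugation by \<open>h\<close> commutes with taking powers and permutes the candidates
  for \<sigma>.\<close>

lemma card_conjugate_powers:
  assumes "h \<in> Sn n"
  shows "card {\<sigma> \<in> Sn n. h \<circ> \<gamma> = (\<sigma> ^^ k) \<circ> h} = card {\<sigma> \<in> Sn n. \<gamma> = \<sigma> ^^ k}"
proof -
  have iff: "h \<circ> \<gamma> = (\<sigma> ^^ k) \<circ> h \<longleftrightarrow> \<gamma> = (inv h \<circ> \<sigma> \<circ> h) ^^ k" if "\<sigma> \<in> Sn n" for \<sigma>
    using Sn_left_cancel[OF assms, of \<gamma> "inv h \<circ> (\<sigma> ^^ k \<circ> h)"] assms
      Sn_funpow_conj[of "inv h" \<sigma> k] that
    by (simp add: comp_assoc)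
  have "bij_betw (\<lambda>\<sigma>. inv h \<circ> \<sigma> \<circ> h) {\<sigma> \<in> Sn n. h \<circ> \<gamma> = (\<sigma> ^^ k) \<circ> h} {\<sigma> \<in> Sn n. \<gamma> = \<sigma> ^^ k}"
    by (rule bij_betw_byWitness[where f' = "\<lambda>\<sigma>. h \<circ> \<sigma> \<circ> inv h"])
      (use assms Sn_funpow_conj[OF assms] in \<open>auto simp: iff comp_assoc\<close>)
  then show ?thesis
    by (rule bij_betw_same_card)
qed

lemma S3_3_eq_Coeff: "S3_3 n = (\<Sum>p\<in>partitions n. (Coeff Z3 n p) ^ 2 * of_nat (Sym n p))"
proof -
  \<comment> \<open>Count the triples \<open>(\<gamma>, \<sigma>, h)\<close> with \<open>h\<gamma>\<^sup>3h\<^sup>-\<^sup>1 = \<sigma>\<^sup>3\<close> in two ways: conjugating \<open>\<sigma>\<close> by \<open>h\<close> makes \<open>h\<close>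
    free, while for fixed \<open>\<gamma>, \<sigma>\<close> the number of \<open>h\<close> depends only on the cycle types of the cubes.\<close>
  let ?t = "\<lambda>\<gamma>. perm_type (\<gamma> ^^ 3)"
  let ?R = "\<lambda>p. card {\<gamma> \<in> Sn n. ?t \<gamma> = p}"
  have "fact n * (\<Sum>\<gamma>\<in>Sn n. card {\<sigma> \<in> Sn n. \<gamma> ^^ 3 = \<sigma> ^^ 3}) =
      (\<Sum>\<gamma>\<in>Sn n. \<Sum>h\<in>Sn n. card {\<sigma> \<in> Sn n. h \<circ> \<gamma> ^^ 3 = (\<sigma> ^^ 3) \<circ> h})"
    by (simp add: card_conjugate_powers card_Sn sum_distrib_left cong: sum.cong)
  also have "\<dots> = (\<Sum>\<gamma>\<in>Sn n. \<Sum>h\<in>Sn n. \<Sum>\<sigma>\<in>Sn n. of_bool (h \<circ> \<gamma> ^^ 3 = (\<sigma> ^^ 3) \<circ> h))"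
    using card_eq_sum_of_bool[OF finite_Sn, where 'a = nat] by simp
  also have "\<dots> = (\<Sum>\<gamma>\<in>Sn n. \<Sum>\<sigma>\<in>Sn n. card {h \<in> Sn n. h \<circ> \<gamma> ^^ 3 = (\<sigma> ^^ 3) \<circ> h})"
    unfolding card_eq_sum_of_bool[OF finite_Sn, where 'a = nat, unfolded of_nat_id]
    by (rule sum.cong[OF refl], rule sum.swap)
  also have "\<dots> = (\<Sum>\<gamma>\<in>Sn n. \<Sum>\<sigma>\<in>Sn n. if ?t \<sigma> = ?t \<gamma> then sym_size (?t \<gamma>) else 0)"
    by (intro sum.cong refl) (auto simp: card_conjugators Sn_funpow)
  \<comment> \<open>For fixed \<gamma> only those \<sigma> contribute whose cube has the type of the
    cube of \<gamma>.\<close>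
  also have "\<dots> = (\<Sum>\<gamma>\<in>Sn n. ?R (?t \<gamma>) * sym_size (?t \<gamma>))"
    using finite_Sn by (simp add: sum.inter_filter[symmetric])
  finally have nat_eq: "fact n * (\<Sum>\<gamma>\<in>Sn n. card {\<sigma> \<in> Sn n. \<gamma> ^^ 3 = \<sigma> ^^ 3}) =
      (\<Sum>\<gamma>\<in>Sn n. ?R (?t \<gamma>) * sym_size (?t \<gamma>))" .
  have "fact n * of_nat (\<Sum>\<gamma>\<in>Sn n. card {\<sigma> \<in> Sn n. \<gamma> ^^ 3 = \<sigma> ^^ 3}) =
      (\<Sum>\<gamma>\<in>Sn n. of_nat (?R (?t \<gamma>) * sym_size (?t \<gamma>)) :: rat)"
    using arg_cong[OF nat_eq, of "of_nat :: nat \<Rightarrow> rat"]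
    by (simp only: of_nat_fact of_nat_mult of_nat_sum)
  also have "\<dots> = (\<Sum>p\<in>partitions n. of_nat (?R p) * of_nat (?R p * sym_size p))"
    by (rule sum_by_type) (simp add: perm_type_in_partitions Sn_funpow)
  \<comment> \<open>One \<open>fact n\<close> is the normalization of \<open>S3_3\<close>, the other
    comes from the free \<open>h\<close>; together they turn the two factors \<open>?R p\<close>
    into two coefficients of \<open>Z3\<close>.\<close>
  finally have "of_nat (\<Sum>\<gamma>\<in>Sn n. card {\<sigma> \<in> Sn n. \<gamma> ^^ 3 = \<sigma> ^^ 3}) / fact n =
      (\<Sum>p\<in>partitions n. of_nat (?R p) * of_nat (?R p * sym_size p)) / (fact n * fact n :: rat)"
    by (simp add: field_simps)
  then show ?thesis
    unfolding S3_3_eq_card sum_cube_solutions sum_divide_distrib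
    by (simp add: Z3_def Coeff_power_type Sym_eq_sym_size power2_eq_square sum_divide_distrib
        mult.assoc cong: sum.cong)
qed

end

section \<open>Orbit counting\<close>

text \<open>Burnside's lemma in division-free form. In place of a group structure it assumes the
  consequences used: orbits of related points coincide, and the elements moving \<open>x\<close> to
  a given point of its orbit are as many as its stabilizer has.\<close>

lemma card_orbits:
  fixes act :: "'g \<Rightarrow> 'x \<Rightarrow> 'x"
  assumes "finite G" "finite Y"
    and bij: "\<And>g. g \<in> G \<Longrightarrow> bij_betw (act g) Y Y"
    and refl: "\<And>x. x \<in> Y \<Longrightarrow> x \<in> (\<lambda>g. act g x) ` G"
    and orbit_eq: "\<And>x g. x \<in> Y \<Longrightarrow> g \<in> G \<Longrightarrow>
      (\<lambda>h. act h (act g x)) ` G = (\<lambda>h. act h x) ` G"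
    and coset: "\<And>x g. x \<in> Y \<Longrightarrow> g \<in> G \<Longrightarrow>
      card {h \<in> G. act h x = act g x} = card {h \<in> G. act h x = x}"
  shows "card ((\<lambda>x. (\<lambda>g. act g x) ` G) ` Y) * card G = (\<Sum>g\<in>G. card {x \<in> Y. act g x = x})"
proof -
  let ?O = "\<lambda>x. (\<lambda>g. act g x) ` G"
  have same: "?O x = ?O y" if xy: "x \<in> Y" "y \<in> ?O x" for x y
  proof -
    obtain g where "g \<in> G" "y = act g x"
      using xy(2) by auto
    then show ?thesis
      using orbit_eq[OF xy(1)] by simp
  qed
  \<comment> \<open>With \<open>y\<close> fixed in an orbit, replace each stabilizer of
    \<open>x\<close> by the equally large set of elements moving \<open>x\<close> to
    \<open>y\<close>. Every \<open>g\<close> moves exactly one \<open>x\<close> of the orbit to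
    \<open>y\<close>, so the total is \<open>card G\<close>.\<close>
  have fiber: "(\<Sum>x\<in>{x \<in> Y. ?O x = ?O y}. card {g \<in> G. act g x = x}) = card G" if y: "y \<in> Y" for y
  proof -
    have stab: "card {g \<in> G. act g x = x} = (\<Sum>g\<in>G. of_bool (act g x = y))"
      if x: "x \<in> {x \<in> Y. ?O x = ?O y}" for x
    proof -
      have "y \<in> ?O x" "x \<in> Y" using x refl[OF y] by auto
      then have "card {g \<in> G. act g x = x} = card {g \<in> G. act g x = y}"
        using coset by force
      then show ?thesis
        using card_eq_sum_of_bool[OF assms(1), where 'a = nat] by simp
    qed
    have one: "(\<Sum>x\<in>{x \<in> Y. ?O x = ?O y}. of_bool (act g x = y)) = (1 :: nat)" if g: "g \<in> G" for g
    proof -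
      obtain x where x: "x \<in> Y" "act g x = y"
        using bij[OF g] y by (metis bij_betw_imp_surj_on imageE)
      have uniq: "x' = x" if "x' \<in> Y" "act g x' = y" for x'
        using that x bij_betw_imp_inj_on[OF bij[OF g]] by (metis inj_onD)
      have "?O x = ?O y"
        using same[OF x(1)] g x(2) by blast
      then have "{x' \<in> {x \<in> Y. ?O x = ?O y}. act g x' = y} = {x}"
        using x uniq by blast
      moreover have "finite {x \<in> Y. ?O x = ?O y}"
        using assms(2) by simp
      ultimately show ?thesis
        using card_eq_sum_of_bool[of "{x \<in> Y. ?O x = ?O y}" "\<lambda>x. act g x = y", where 'a = nat]
        by simp
    qed
    have "(\<Sum>x\<in>{x \<in> Y. ?O x = ?O y}. card {g \<in> G. act g x = x}) =
        (\<Sum>x\<in>{x \<in> Y. ?O x = ?O y}. \<Sum>g\<in>G. of_bool (act g x = y))"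
      using stab by (rule sum.cong[OF HOL.refl])
    also have "\<dots> = (\<Sum>g\<in>G. \<Sum>x\<in>{x \<in> Y. ?O x = ?O y}. of_bool (act g x = y))"
      by (rule sum.swap)
    also have "\<dots> = (\<Sum>g\<in>G. 1)"
      using one by (rule sum.cong[OF HOL.refl])
    finally show ?thesis by simp
  qed
  have "(\<Sum>g\<in>G. card {x \<in> Y. act g x = x}) = (\<Sum>x\<in>Y. card {g \<in> G. act g x = x})"
    unfolding card_eq_sum_of_bool[OF assms(1), where 'a = nat, unfolded of_nat_id]
      card_eq_sum_of_bool[OF assms(2), where 'a = nat, unfolded of_nat_id]
    by (rule sum.swap)
  also have "\<dots> = (\<Sum>C\<in>?O ` Y. \<Sum>x\<in>{x \<in> Y. ?O x = C}. card {g \<in> G. act g x = x})"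
    by (rule sum.group[symmetric]) (use assms(2) in auto)
  also have "\<dots> = (\<Sum>C\<in>?O ` Y. card G)"
    by (rule sum.cong[OF HOL.refl]) (use fiber in blast)
  finally show ?thesis by simp
qed

section \<open>Classes of triples as orbits of a product of three symmetric groups\<close>

context
  fixes n :: nat
begin

definition triple_act ::
  "(nat \<Rightarrow> nat) \<times> (nat \<Rightarrow> nat) \<times> (nat \<Rightarrow> nat) \<Rightarrow> (nat \<Rightarrow> nat \<Rightarrow> nat) \<Rightarrow> (nat \<Rightarrow> nat \<Rightarrow> nat)" where
  "triple_act = (\<lambda>(\<gamma>\<^sub>1, \<gamma>\<^sub>2, \<alpha>) \<sigma>. \<lambda>i\<in>{1..3}. \<gamma>\<^sub>1 \<circ> \<sigma> (\<alpha> i) \<circ> \<gamma>\<^sub>2)"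

abbreviation triple_group :: "((nat \<Rightarrow> nat) \<times> (nat \<Rightarrow> nat) \<times> (nat \<Rightarrow> nat)) set" where
  "triple_group \<equiv> Sn n \<times> Sn n \<times> Sn 3"

lemma Sn3_in: "\<alpha> \<in> Sn 3 \<Longrightarrow> i \<in> {1..3} \<longleftrightarrow> \<alpha> i \<in> {1..3}"
  unfolding Sn_def by (metis mem_Collect_eq permutes_in_image)

lemma triple_act_in:
  assumes "g \<in> triple_group" "\<sigma> \<in> triples n"
  shows "triple_act g \<sigma> \<in> triples n"
proof -
  obtain \<gamma>\<^sub>1 \<gamma>\<^sub>2 \<alpha> where g: "g = (\<gamma>\<^sub>1, \<gamma>\<^sub>2, \<alpha>)" "\<gamma>\<^sub>1 \<in> Sn n" "\<gamma>\<^sub>2 \<in> Sn n" "\<alpha> \<in> Sn 3"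
    using assms(1) by auto
  have "\<sigma> (\<alpha> i) \<in> Sn n" if "i \<in> {1..3}" for i
    using assms(2) Sn3_in[OF g(4)] that unfolding triples_def by (metis PiE_mem)
  then show ?thesis
    unfolding g(1) triple_act_def triples_def prod.case using g(2,3)
    by (intro restrict_PiE_iff[THEN iffD2] ballI Sn_closed)
qed

lemma triple_act_mult:
  assumes "\<alpha> \<in> Sn 3"
  shows "triple_act (\<gamma>\<^sub>1, \<gamma>\<^sub>2, \<alpha>) (triple_act (\<delta>\<^sub>1, \<delta>\<^sub>2, \<beta>) \<sigma>) =
    triple_act (\<gamma>\<^sub>1 \<circ> \<delta>\<^sub>1, \<delta>\<^sub>2 \<circ> \<gamma>\<^sub>2, \<beta> \<circ> \<alpha>) \<sigma>"
  unfolding triple_act_def using Sn3_in[OF assms] by (intro ext) (simp add: comp_assoc)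

lemma triple_act_id:
  assumes "\<sigma> \<in> triples n"
  shows "triple_act (id, id, id) \<sigma> = \<sigma>"
proof
  fix i
  show "triple_act (id, id, id) \<sigma> i = \<sigma> i"
    using PiE_arb[OF assms[unfolded triples_def], of i]
    unfolding triple_act_def by (cases "i \<in> {1..3}") simp_all
qed

lemma triple_act_inverse:
  assumes "\<gamma>\<^sub>1 \<in> Sn n" "\<gamma>\<^sub>2 \<in> Sn n" "\<alpha> \<in> Sn 3" "\<sigma> \<in> triples n"
  shows "triple_act (inv \<gamma>\<^sub>1, inv \<gamma>\<^sub>2, inv \<alpha>) (triple_act (\<gamma>\<^sub>1, \<gamma>\<^sub>2, \<alpha>) \<sigma>) = \<sigma>"
    and "triple_act (\<gamma>\<^sub>1, \<gamma>\<^sub>2, \<alpha>) (triple_act (inv \<gamma>\<^sub>1, inv \<gamma>\<^sub>2, inv \<alpha>) \<sigma>) = \<sigma>"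
  using assms by (simp_all add: triple_act_mult triple_act_id)

lemma finite_triples: "finite (triples n)"
  unfolding triples_def using finite_Sn by (intro finite_PiE) auto

text \<open>Each generating step is the action of a group element with some components equal to
  \<open>id\<close>, and a backward step is undone by the inverse element. Conversely, every group
  element acts as a relabelling followed by a multiplication.\<close>

lemma triple_class_eq_orbit:
  assumes "\<sigma> \<in> triples n"
  shows "{\<tau>. equivclp (triple_step n) \<sigma> \<tau>} = (\<lambda>g. triple_act g \<sigma>) ` triple_group"
proof -
  let ?O = "\<lambda>\<sigma>. (\<lambda>g. triple_act g \<sigma>) ` triple_group"
  have step_act: "\<tau> \<in> triples n \<and> \<upsilon> \<in> triples n \<and> (\<exists>g\<in>triple_group. \<upsilon> = triple_act g \<tau>)"
    if "triple_step n \<tau> \<upsilon>" for \<tau> \<upsilon>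
    using that
  proof cases
    case (multiply \<gamma>\<^sub>1 \<gamma>\<^sub>2)
    then have "\<upsilon> = triple_act (\<gamma>\<^sub>1, \<gamma>\<^sub>2, id) \<tau>" "(\<gamma>\<^sub>1, \<gamma>\<^sub>2, id) \<in> triple_group"
      unfolding triple_act_def by auto
    then show ?thesis
      using multiply triple_act_in by blast
  next
    case (relabel \<alpha>)
    then have "\<upsilon> = triple_act (id, id, \<alpha>) \<tau>" "(id, id, \<alpha>) \<in> triple_group"
      unfolding triple_act_def Sn_def by (auto simp: permutes_id)
    then show ?thesis
      using relabel triple_act_in by blast
  qed
  have mult: "triple_act g (triple_act h \<sigma>) \<in> ?O \<sigma>"
    if "g \<in> triple_group" "h \<in> triple_group" for g h
    using that by (cases g, cases h) (auto simp: triple_act_mult intro!: imageI)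
  have "\<tau> \<in> ?O \<sigma>" if "equivclp (triple_step n) \<sigma> \<tau>" for \<tau>
    using that
  proof (induction rule: equivclp_induct)
    case base
    then show ?case
      by (intro image_eqI[of _ _ "(id, id, id)"]) (simp_all add: triple_act_id[OF assms])
  next
    case (step \<tau> \<upsilon>)
    then obtain h where h: "h \<in> triple_group" "\<tau> = triple_act h \<sigma>" by auto
    from step(2) show ?case
    proof
      assume "triple_step n \<tau> \<upsilon>"
      then show ?thesis
        using step_act mult h by blast
    next
      assume "triple_step n \<upsilon> \<tau>"
      then obtain g where g: "g \<in> triple_group" "\<tau> = triple_act g \<upsilon>" "\<upsilon> \<in> triples n"
        using step_act by blast
      obtain \<gamma>\<^sub>1 \<gamma>\<^sub>2 \<alpha> where g': "g = (\<gamma>\<^sub>1, \<gamma>\<^sub>2, \<alpha>)" by (cases g)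
      have "triple_act (inv \<gamma>\<^sub>1, inv \<gamma>\<^sub>2, inv \<alpha>) \<tau> = \<upsilon>"
        using triple_act_inverse(1) g unfolding g' by simp
      moreover have "(inv \<gamma>\<^sub>1, inv \<gamma>\<^sub>2, inv \<alpha>) \<in> triple_group"
        using g unfolding g' by simp
      ultimately show ?thesis
        using mult h by blast
    qed
  qed
  moreover have "equivclp (triple_step n) \<sigma> (triple_act g \<sigma>)" if g: "g \<in> triple_group" for g
  proof -
    obtain \<gamma>\<^sub>1 \<gamma>\<^sub>2 \<alpha> where g': "g = (\<gamma>\<^sub>1, \<gamma>\<^sub>2, \<alpha>)" by (cases g)
    let ?\<tau> = "\<lambda>i\<in>{1..3}. \<sigma> (\<alpha> i)"
    have "\<alpha> permutes {1..3}"
      using g unfolding g' Sn_def by auto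
    then have 1: "triple_step n \<sigma> ?\<tau>"
      using assms by (intro triple_step.relabel)
    then have "triple_step n ?\<tau> (\<lambda>i\<in>{1..3}. \<gamma>\<^sub>1 \<circ> ?\<tau> i \<circ> \<gamma>\<^sub>2)"
      using g step_act unfolding g' by (intro triple_step.multiply) auto
    moreover have "(\<lambda>i\<in>{1..3}. \<gamma>\<^sub>1 \<circ> ?\<tau> i \<circ> \<gamma>\<^sub>2) = triple_act g \<sigma>"
      unfolding triple_act_def g' by (auto simp: fun_eq_iff)
    ultimately show ?thesis
      using 1 by (metis equivclp_trans r_into_equivclp)
  qed
  ultimately show ?thesis by auto
qed

lemma Z3sc_mult_card:
  "Z3sc n * (fact n * (fact n * 6)) =
    (\<Sum>\<alpha>\<in>Sn 3. \<Sum>\<gamma>\<^sub>1\<in>Sn n. \<Sum>\<gamma>\<^sub>2\<in>Sn n. card {\<sigma> \<in> triples n. triple_act (\<gamma>\<^sub>1, \<gamma>\<^sub>2, \<alpha>) \<sigma> = \<sigma>})"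
proof -
  have id: "(id, id, id) \<in> triple_group" by simp
  have fin: "finite triple_group"
    using finite_Sn[of n] finite_Sn[of 3] by blast
  \<comment> \<open>The coset condition for orbit counting: multiplying by a fixed group element
    carries the stabilizer onto the elements with the same effect on \<sigma> as that
    element.\<close>
  have trans: "bij_betw (\<lambda>(\<delta>\<^sub>1, \<delta>\<^sub>2, \<beta>). (\<gamma>\<^sub>1 \<circ> \<delta>\<^sub>1, \<delta>\<^sub>2 \<circ> \<gamma>\<^sub>2, \<beta> \<circ> \<alpha>))
      {h \<in> triple_group. triple_act h \<sigma> = \<sigma>}
      {h \<in> triple_group. triple_act h \<sigma> = triple_act (\<gamma>\<^sub>1, \<gamma>\<^sub>2, \<alpha>) \<sigma>}"
    if g: "\<gamma>\<^sub>1 \<in> Sn n" "\<gamma>\<^sub>2 \<in> Sn n" "\<alpha> \<in> Sn 3" and \<sigma>: "\<sigma> \<in> triples n" for \<gamma>\<^sub>1 \<gamma>\<^sub>2 \<alpha> \<sigma>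
  proof (rule bij_betw_byWitness[where
        f' = "\<lambda>(\<delta>\<^sub>1, \<delta>\<^sub>2, \<beta>). (inv \<gamma>\<^sub>1 \<circ> \<delta>\<^sub>1, \<delta>\<^sub>2 \<circ> inv \<gamma>\<^sub>2, \<beta> \<circ> inv \<alpha>)"])
    show "(\<lambda>(\<delta>\<^sub>1, \<delta>\<^sub>2, \<beta>). (\<gamma>\<^sub>1 \<circ> \<delta>\<^sub>1, \<delta>\<^sub>2 \<circ> \<gamma>\<^sub>2, \<beta> \<circ> \<alpha>)) ` {h \<in> triple_group. triple_act h \<sigma> = \<sigma>}
        \<subseteq> {h \<in> triple_group. triple_act h \<sigma> = triple_act (\<gamma>\<^sub>1, \<gamma>\<^sub>2, \<alpha>) \<sigma>}"
      using g by (auto simp: triple_act_mult[symmetric])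
    show "(\<lambda>(\<delta>\<^sub>1, \<delta>\<^sub>2, \<beta>). (inv \<gamma>\<^sub>1 \<circ> \<delta>\<^sub>1, \<delta>\<^sub>2 \<circ> inv \<gamma>\<^sub>2, \<beta> \<circ> inv \<alpha>)) `
        {h \<in> triple_group. triple_act h \<sigma> = triple_act (\<gamma>\<^sub>1, \<gamma>\<^sub>2, \<alpha>) \<sigma>}
        \<subseteq> {h \<in> triple_group. triple_act h \<sigma> = \<sigma>}"
      using g triple_act_inverse(1)[OF g \<sigma>] by (auto simp: triple_act_mult[symmetric])
  qed (use g in \<open>auto simp: comp_assoc\<close>)
  have "Z3sc n = card ((\<lambda>\<sigma>. (\<lambda>g. triple_act g \<sigma>) ` triple_group) ` triples n)"
    unfolding Z3sc_def quotient_def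
    by (rule arg_cong[where f = card])
      (use triple_class_eq_orbit in \<open>auto simp: Image_def\<close>)
  also have "card ((\<lambda>\<sigma>. (\<lambda>g. triple_act g \<sigma>) ` triple_group) ` triples n) * card triple_group =
      (\<Sum>g\<in>triple_group. card {\<sigma> \<in> triples n. triple_act g \<sigma> = \<sigma>})"
  proof (rule card_orbits[OF fin finite_triples])
    fix g assume "g \<in> triple_group"
    then obtain \<gamma>\<^sub>1 \<gamma>\<^sub>2 \<alpha> where g: "g = (\<gamma>\<^sub>1, \<gamma>\<^sub>2, \<alpha>)" "\<gamma>\<^sub>1 \<in> Sn n" "\<gamma>\<^sub>2 \<in> Sn n" "\<alpha> \<in> Sn 3" by auto
    let ?i = "(inv \<gamma>\<^sub>1, inv \<gamma>\<^sub>2, inv \<alpha>)"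
    have i: "?i \<in> triple_group" using g by simp
    show "bij_betw (triple_act g) (triples n) (triples n)"
      by (rule bij_betw_byWitness[where f' = "triple_act ?i"])
        (use triple_act_inverse g triple_act_in i \<open>g \<in> triple_group\<close> in auto)
    fix \<sigma> assume \<sigma>: "\<sigma> \<in> triples n"
    show "card {h \<in> triple_group. triple_act h \<sigma> = triple_act g \<sigma>} =
        card {h \<in> triple_group. triple_act h \<sigma> = \<sigma>}"
      using bij_betw_same_card[OF trans[OF g(2-4) \<sigma>]] g(1) by simp
    \<comment> \<open>One inclusion for every group element suffices: applied to the inverse it
      gives the other inclusion.\<close>
    have sub: "(\<lambda>h. triple_act h (triple_act g \<tau>)) ` triple_group \<subseteq> (\<lambda>h. triple_act h \<tau>) ` triple_group"
      if "g \<in> triple_group" for g \<tau>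
      using that by (cases g) (auto simp: triple_act_mult intro!: imageI)
    show "(\<lambda>h. triple_act h (triple_act g \<sigma>)) ` triple_group = (\<lambda>h. triple_act h \<sigma>) ` triple_group"
      using sub[OF \<open>g \<in> triple_group\<close>, of \<sigma>] sub[OF i, of "triple_act g \<sigma>"]
        triple_act_inverse(1)[OF g(2-4) \<sigma>] unfolding g(1) by simp
  next
    fix \<sigma> assume "\<sigma> \<in> triples n"
    then show "\<sigma> \<in> (\<lambda>g. triple_act g \<sigma>) ` triple_group"
      by (intro image_eqI[OF _ id]) (simp add: triple_act_id)
  qed
  also have "\<dots> = (\<Sum>\<alpha>\<in>Sn 3. \<Sum>\<gamma>\<^sub>1\<in>Sn n. \<Sum>\<gamma>\<^sub>2\<in>Sn n.
      card {\<sigma> \<in> triples n. triple_act (\<gamma>\<^sub>1, \<gamma>\<^sub>2, \<alpha>) \<sigma> = \<sigma>})"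
    unfolding sum.cartesian_product' case_prod_unfold
    by (subst (2) sum.swap, subst sum.swap) simp
  finally show ?thesis
    by (simp add: card_Sn card_cartesian_product fact_numeral)
qed

end

section \<open>Fixed triples, with the positions named \<open>a\<close>, \<open>b\<close>,
  \<open>c\<close> so that one computation serves each cycle type of \<alpha>\<close>

context
  fixes n a b c :: nat
  assumes abc: "{1..3} = {a, b, c}" "a \<noteq> b" "a \<noteq> c" "b \<noteq> c"
begin

lemma triples_eq: "triples n = {a, b, c} \<rightarrow>\<^sub>E Sn n"
  unfolding triples_def abc(1) ..

lemma bij_betw_triples:
  "bij_betw (\<lambda>\<sigma>. (\<sigma> a, \<sigma> b, \<sigma> c)) (triples n) (Sn n \<times> Sn n \<times> Sn n)"
proof (rule bij_betw_byWitness[where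
      f' = "\<lambda>(x, y, z). \<lambda>i\<in>{a, b, c}. if i = a then x else if i = b then y else z"])
  show "\<forall>\<sigma>\<in>triples n. (\<lambda>(x, y, z). \<lambda>i\<in>{a, b, c}. if i = a then x else if i = b then y else z)
      (\<sigma> a, \<sigma> b, \<sigma> c) = \<sigma>"
  proof (rule ballI, rule ext)
    fix \<sigma> i assume "\<sigma> \<in> triples n"
    then show "(\<lambda>(x, y, z). \<lambda>i\<in>{a, b, c}. if i = a then x else if i = b then y else z)
      (\<sigma> a, \<sigma> b, \<sigma> c) i = \<sigma> i"
      using PiE_arb[of \<sigma> "{a, b, c}" "\<lambda>_. Sn n" i] unfolding triples_eq
      by (cases "i \<in> {a, b, c}") auto
  qed
  show "(\<lambda>\<sigma>. (\<sigma> a, \<sigma> b, \<sigma> c)) ` triples n \<subseteq> Sn n \<times> Sn n \<times> Sn n"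
    unfolding triples_eq by (auto dest: PiE_mem)
qed (use abc(2-4) in \<open>auto simp: triples_eq\<close>)

lemma triple_act_fixed_iff:
  assumes "\<sigma> \<in> triples n"
  shows "triple_act (\<gamma>\<^sub>1, \<gamma>\<^sub>2, \<alpha>) \<sigma> = \<sigma> \<longleftrightarrow> \<gamma>\<^sub>1 \<circ> \<sigma> (\<alpha> a) \<circ> \<gamma>\<^sub>2 = \<sigma> a \<and>
    \<gamma>\<^sub>1 \<circ> \<sigma> (\<alpha> b) \<circ> \<gamma>\<^sub>2 = \<sigma> b \<and> \<gamma>\<^sub>1 \<circ> \<sigma> (\<alpha> c) \<circ> \<gamma>\<^sub>2 = \<sigma> c"
proof -
  have "triple_act (\<gamma>\<^sub>1, \<gamma>\<^sub>2, \<alpha>) \<sigma> = \<sigma> \<longleftrightarrow> (\<forall>i\<in>{1..3}. \<gamma>\<^sub>1 \<circ> \<sigma> (\<alpha> i) \<circ> \<gamma>\<^sub>2 = \<sigma> i)"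
  proof
    assume *: "\<forall>i\<in>{1..3}. \<gamma>\<^sub>1 \<circ> \<sigma> (\<alpha> i) \<circ> \<gamma>\<^sub>2 = \<sigma> i"
    show "triple_act (\<gamma>\<^sub>1, \<gamma>\<^sub>2, \<alpha>) \<sigma> = \<sigma>"
    proof
      fix i
      show "triple_act (\<gamma>\<^sub>1, \<gamma>\<^sub>2, \<alpha>) \<sigma> i = \<sigma> i"
        using * PiE_arb[OF assms[unfolded triples_def], of i]
        unfolding triple_act_def by (cases "i \<in> {1..3}") simp_all
    qed
  next
    assume *: "triple_act (\<gamma>\<^sub>1, \<gamma>\<^sub>2, \<alpha>) \<sigma> = \<sigma>"
    show "\<forall>i\<in>{1..3}. \<gamma>\<^sub>1 \<circ> \<sigma> (\<alpha> i) \<circ> \<gamma>\<^sub>2 = \<sigma> i"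
      using fun_cong[OF *] unfolding triple_act_def by (metis (no_types, lifting) prod.case restrict_apply')
  qed
  then show ?thesis
    unfolding abc(1) by simp
qed

text \<open>Turns the fixed-point count for one \<alpha> into a count of 5-tuples, with
  \<open>Q\<close> standing for the fixed-point equations; what remains is a change of
  variables.\<close>

lemma sum_fixed_triples:
  assumes "\<And>\<gamma>\<^sub>1 \<gamma>\<^sub>2 \<sigma>. \<sigma> \<in> triples n \<Longrightarrow>
    triple_act (\<gamma>\<^sub>1, \<gamma>\<^sub>2, \<alpha>) \<sigma> = \<sigma> \<longleftrightarrow> Q \<gamma>\<^sub>1 \<gamma>\<^sub>2 (\<sigma> a) (\<sigma> b) (\<sigma> c)"
  shows "(\<Sum>\<gamma>\<^sub>1\<in>Sn n. \<Sum>\<gamma>\<^sub>2\<in>Sn n. card {\<sigma> \<in> triples n. triple_act (\<gamma>\<^sub>1, \<gamma>\<^sub>2, \<alpha>) \<sigma> = \<sigma>}) =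
    card {(\<gamma>\<^sub>1, \<gamma>\<^sub>2, x, y, z) \<in> Sn n \<times> Sn n \<times> Sn n \<times> Sn n \<times> Sn n. Q \<gamma>\<^sub>1 \<gamma>\<^sub>2 x y z}"
proof -
  let ?S = "Sn n"
  let ?W = "\<lambda>\<gamma>\<^sub>1 \<gamma>\<^sub>2. {(x, y, z) \<in> ?S \<times> ?S \<times> ?S. Q \<gamma>\<^sub>1 \<gamma>\<^sub>2 x y z}"
  have fin: "finite (?S \<times> ?S \<times> ?S)"
    using finite_Sn[of n] by auto
  have "card {\<sigma> \<in> triples n. triple_act (\<gamma>\<^sub>1, \<gamma>\<^sub>2, \<alpha>) \<sigma> = \<sigma>} =
      card (?W \<gamma>\<^sub>1 \<gamma>\<^sub>2)" for \<gamma>\<^sub>1 \<gamma>\<^sub>2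
  proof -
    have "card {\<sigma> \<in> triples n. triple_act (\<gamma>\<^sub>1, \<gamma>\<^sub>2, \<alpha>) \<sigma> = \<sigma>} =
        (\<Sum>\<sigma>\<in>triples n. of_bool (triple_act (\<gamma>\<^sub>1, \<gamma>\<^sub>2, \<alpha>) \<sigma> = \<sigma>))"
      using card_eq_sum_of_bool[OF finite_triples, where 'a = nat] by (metis of_nat_id)
    also have "\<dots> = (\<Sum>\<sigma>\<in>triples n. of_bool
        (case (\<sigma> a, \<sigma> b, \<sigma> c) of (x, y, z) \<Rightarrow> Q \<gamma>\<^sub>1 \<gamma>\<^sub>2 x y z))"
      using assms by (intro sum.cong) auto
    also have "\<dots> = (\<Sum>w\<in>?S \<times> ?S \<times> ?S. of_bool (case w of (x, y, z) \<Rightarrow> Q \<gamma>\<^sub>1 \<gamma>\<^sub>2 x y z))"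
      by (rule sum.reindex_bij_betw[OF bij_betw_triples])
    also have "\<dots> = card {w \<in> ?S \<times> ?S \<times> ?S. case w of (x, y, z) \<Rightarrow> Q \<gamma>\<^sub>1 \<gamma>\<^sub>2 x y z}"
      using card_eq_sum_of_bool[OF fin, where 'a = nat] by (metis of_nat_id)
    also have "{w \<in> ?S \<times> ?S \<times> ?S. case w of (x, y, z) \<Rightarrow> Q \<gamma>\<^sub>1 \<gamma>\<^sub>2 x y z} = ?W \<gamma>\<^sub>1 \<gamma>\<^sub>2"
      by auto
    finally show ?thesis .
  qed
  moreover have "{(\<gamma>\<^sub>1, \<gamma>\<^sub>2, x, y, z) \<in> ?S \<times> ?S \<times> ?S \<times> ?S \<times> ?S. Q \<gamma>\<^sub>1 \<gamma>\<^sub>2 x y z} =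
      (SIGMA \<gamma>\<^sub>1:?S. SIGMA \<gamma>\<^sub>2:?S. ?W \<gamma>\<^sub>1 \<gamma>\<^sub>2)" by auto
  moreover have "finite (?W \<gamma>\<^sub>1 \<gamma>\<^sub>2)" for \<gamma>\<^sub>1 \<gamma>\<^sub>2
    using fin by (rule rev_finite_subset) auto
  ultimately show ?thesis
    using finite_Sn[of n] by simp
qed

text \<open>A position fixed by \<alpha> determines the right multiplier from the left one and the
  entry there.\<close>

lemma conj_solve:
  assumes "g \<in> Sn n" "x \<in> Sn n" "g \<circ> x \<circ> g' = x"
  shows "g' = inv x \<circ> (inv g \<circ> x)"
proof -
  have "inv x \<circ> (inv g \<circ> (g \<circ> x \<circ> g')) = g'"
    using assms(1,2) by (simp add: comp_assoc)
  then show ?thesis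
    unfolding assms(3) by simp
qed

text \<open>The first entry \<open>x\<close> is free and determines \<open>g'\<close>. In the new
  variables \<open>u = y \<circ> inv x\<close> and \<open>v = z \<circ> inv x\<close>, the other two
  equations say that \<open>u\<close> and \<open>v\<close> commute with \<open>g\<close>, giving the
  square of a centralizer order.\<close>

lemma sum_fixed_id:
  "(\<Sum>\<gamma>\<^sub>1\<in>Sn n. \<Sum>\<gamma>\<^sub>2\<in>Sn n. card {\<sigma> \<in> triples n. triple_act (\<gamma>\<^sub>1, \<gamma>\<^sub>2, id) \<sigma> = \<sigma>}) =
    fact n * (\<Sum>\<gamma>\<in>Sn n. card {\<sigma> \<in> Sn n. \<sigma> \<circ> \<gamma> = \<gamma> \<circ> \<sigma>} ^ 2)"
proof -
  let ?S = "Sn n"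
  let ?Q = "{(g, g', x, y, z) \<in> ?S \<times> ?S \<times> ?S \<times> ?S \<times> ?S.
    g \<circ> x \<circ> g' = x \<and> g \<circ> y \<circ> g' = y \<and> g \<circ> z \<circ> g' = z}"
  let ?B = "{(g, x, u, v) \<in> ?S \<times> ?S \<times> ?S \<times> ?S. u \<circ> g = g \<circ> u \<and> v \<circ> g = g \<circ> v}"
  have comm: "y \<circ> inv x \<circ> g = g \<circ> (y \<circ> inv x)"
    if "g \<in> ?S" "x \<in> ?S" "y \<in> ?S" "g \<circ> x \<circ> g' = x" "g \<circ> y \<circ> g' = y" for g g' x y
  proof -
    have "y \<circ> inv x \<circ> g = g \<circ> y \<circ> g' \<circ> inv x \<circ> g"
      using that(5) by simp
    also have "\<dots> = g \<circ> (y \<circ> inv x)"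
      unfolding conj_solve[OF that(1,2,4)] using that(1-3) by (simp add: comp_assoc)
    finally show ?thesis .
  qed
  have fixed: "g \<circ> (u \<circ> (inv g \<circ> x)) = u \<circ> x"
    if "g \<in> ?S" "u \<circ> g = g \<circ> u" for g u x
  proof -
    have "g \<circ> (u \<circ> (inv g \<circ> x)) = g \<circ> u \<circ> (inv g \<circ> x)"
      by (simp only: comp_assoc)
    also have "\<dots> = u \<circ> x"
      unfolding that(2)[symmetric] using that(1) by (simp add: comp_assoc)
    finally show ?thesis .
  qed
  have "bij_betw (\<lambda>(g, g', x, y, z). (g, x, y \<circ> inv x, z \<circ> inv x)) ?Q ?B"
  proof (rule bij_betw_byWitness[where
        f' = "\<lambda>(g, x, u, v). (g, inv x \<circ> (inv g \<circ> x), x, u \<circ> x, v \<circ> x)"])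
    show "(\<lambda>(g, g', x, y, z). (g, x, y \<circ> inv x, z \<circ> inv x)) ` ?Q \<subseteq> ?B"
      using comm by auto
    show "(\<lambda>(g, x, u, v). (g, inv x \<circ> (inv g \<circ> x), x, u \<circ> x, v \<circ> x)) ` ?B \<subseteq> ?Q"
      using fixed by (auto simp: comp_assoc)
  qed (use conj_solve in \<open>auto simp: comp_assoc\<close>)
  note bij = this
  have "(\<Sum>\<gamma>\<^sub>1\<in>?S. \<Sum>\<gamma>\<^sub>2\<in>?S. card {\<sigma> \<in> triples n. triple_act (\<gamma>\<^sub>1, \<gamma>\<^sub>2, id) \<sigma> = \<sigma>}) = card ?Q"
    by (rule sum_fixed_triples) (simp add: triple_act_fixed_iff id_apply)
  also have "card ?Q = card ?B"
    by (rule bij_betw_same_card[OF bij])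
  also have "?B = (SIGMA g:?S. ?S \<times> {u \<in> ?S. u \<circ> g = g \<circ> u} \<times> {u \<in> ?S. u \<circ> g = g \<circ> u})"
    by auto
  also have "card \<dots> = (\<Sum>g\<in>?S. fact n * card {u \<in> ?S. u \<circ> g = g \<circ> u} ^ 2)"
    using finite_Sn[of n] by (simp add: card_cartesian_product card_Sn power2_eq_square)
  finally show ?thesis
    unfolding sum_distrib_left .
qed

text \<open>The entry \<open>z\<close> at the fixed position is free and determines
  \<open>g'\<close>. The swapped entries satisfy \<open>y = g \<circ> x \<circ> g'\<close>; applying
  this twice says that \<open>u = x \<circ> inv z\<close> commutes with the square of
  \<open>g\<close>.\<close>

lemma sum_fixed_transposition:
  assumes "\<alpha> a = b" "\<alpha> b = a" "\<alpha> c = c"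
  shows "(\<Sum>\<gamma>\<^sub>1\<in>Sn n. \<Sum>\<gamma>\<^sub>2\<in>Sn n. card {\<sigma> \<in> triples n. triple_act (\<gamma>\<^sub>1, \<gamma>\<^sub>2, \<alpha>) \<sigma> = \<sigma>}) =
    fact n * (\<Sum>\<gamma>\<in>Sn n. card {\<sigma> \<in> Sn n. \<sigma> \<circ> \<gamma> ^^ 2 = \<gamma> ^^ 2 \<circ> \<sigma>})"
proof -
  let ?S = "Sn n"
  let ?Q = "{(g, g', x, y, z) \<in> ?S \<times> ?S \<times> ?S \<times> ?S \<times> ?S.
    g \<circ> y \<circ> g' = x \<and> g \<circ> x \<circ> g' = y \<and> g \<circ> z \<circ> g' = z}"
  let ?B = "{(g, x, u) \<in> ?S \<times> ?S \<times> ?S. u \<circ> (g \<circ> g) = g \<circ> (g \<circ> u)}"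
  have comm: "x \<circ> inv z \<circ> (g \<circ> g) = g \<circ> (g \<circ> (x \<circ> inv z))"
    if "g \<in> ?S" "x \<in> ?S" "z \<in> ?S" "g \<circ> z \<circ> g' = z" "g \<circ> (g \<circ> x \<circ> g') \<circ> g' = x" for g g' x z
  proof -
    have "x \<circ> inv z \<circ> (g \<circ> g) = g \<circ> (g \<circ> x \<circ> g') \<circ> g' \<circ> inv z \<circ> (g \<circ> g)"
      using that(5) by simp
    also have "\<dots> = g \<circ> (g \<circ> (x \<circ> inv z))"
      unfolding conj_solve[OF that(1,3,4)] using that(1-3) by (simp add: comp_assoc)
    finally show ?thesis .
  qed
  have fixed: "g \<circ> (g \<circ> (u \<circ> (inv g \<circ> (inv g \<circ> x)))) = u \<circ> x"
    if "g \<in> ?S" "u \<circ> (g \<circ> g) = g \<circ> (g \<circ> u)" for g u x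
  proof -
    have "g \<circ> (g \<circ> (u \<circ> (inv g \<circ> (inv g \<circ> x)))) = g \<circ> (g \<circ> u) \<circ> (inv g \<circ> (inv g \<circ> x))"
      by (simp only: comp_assoc)
    also have "\<dots> = u \<circ> x"
      unfolding that(2)[symmetric] using that(1) by (simp add: comp_assoc)
    finally show ?thesis .
  qed
  have "bij_betw (\<lambda>(g, g', x, y, z). (g, z, x \<circ> inv z)) ?Q ?B"
  \<comment> \<open>The fourth component recovers \<open>y\<close>: it is
    \<open>g \<circ> x \<circ> g'\<close> with \<open>x = u \<circ> z\<close> and
    \<open>g' = inv z \<circ> (inv g \<circ> z)\<close> substituted.\<close>
  proof (rule bij_betw_byWitness[where f' = "\<lambda>(g, z, u).
        (g, inv z \<circ> (inv g \<circ> z), u \<circ> z, g \<circ> (u \<circ> (inv g \<circ> z)), z)"])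
    show "\<forall>q\<in>?Q. (\<lambda>(g, z, u). (g, inv z \<circ> (inv g \<circ> z), u \<circ> z, g \<circ> (u \<circ> (inv g \<circ> z)), z))
        ((\<lambda>(g, g', x, y, z). (g, z, x \<circ> inv z)) q) = q"
    proof
      fix q assume "q \<in> ?Q"
      then obtain g g' x y z where q: "q = (g, g', x, y, z)" "g \<in> ?S" "x \<in> ?S" "z \<in> ?S"
        "g \<circ> x \<circ> g' = y" "g \<circ> z \<circ> g' = z" by auto
      show "(\<lambda>(g, z, u). (g, inv z \<circ> (inv g \<circ> z), u \<circ> z, g \<circ> (u \<circ> (inv g \<circ> z)), z))
        ((\<lambda>(g, g', x, y, z). (g, z, x \<circ> inv z)) q) = q"
        using q(2-4) conj_solve[OF q(2,4,6)] unfolding q(1) q(5)[symmetric] by (simp add: comp_assoc)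
    qed
    show "(\<lambda>(g, g', x, y, z). (g, z, x \<circ> inv z)) ` ?Q \<subseteq> ?B"
    proof
      fix w assume "w \<in> (\<lambda>(g, g', x, y, z). (g, z, x \<circ> inv z)) ` ?Q"
      then obtain g g' x y z where w: "w = (g, z, x \<circ> inv z)" and q: "g \<in> ?S" "x \<in> ?S" "z \<in> ?S"
        "g \<circ> y \<circ> g' = x" "g \<circ> x \<circ> g' = y" "g \<circ> z \<circ> g' = z" by auto
      then show "w \<in> ?B"
        using comm[OF q(1-3,6)] by simp
    qed
    show "(\<lambda>(g, z, u). (g, inv z \<circ> (inv g \<circ> z), u \<circ> z, g \<circ> (u \<circ> (inv g \<circ> z)), z)) ` ?B \<subseteq> ?Q"
      using fixed by (auto simp: comp_assoc)
  qed (auto simp: comp_assoc)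
  note bij = this
  have "(\<Sum>\<gamma>\<^sub>1\<in>?S. \<Sum>\<gamma>\<^sub>2\<in>?S. card {\<sigma> \<in> triples n. triple_act (\<gamma>\<^sub>1, \<gamma>\<^sub>2, \<alpha>) \<sigma> = \<sigma>}) = card ?Q"
    by (rule sum_fixed_triples) (simp add: triple_act_fixed_iff assms)
  also have "card ?Q = card ?B"
    by (rule bij_betw_same_card[OF bij])
  also have "?B = (SIGMA g:?S. ?S \<times> {u \<in> ?S. u \<circ> g ^^ 2 = g ^^ 2 \<circ> u})"
    by (auto simp: numeral_2_eq_2 comp_assoc)
  also have "card \<dots> = (\<Sum>g\<in>?S. fact n * card {u \<in> ?S. u \<circ> g ^^ 2 = g ^^ 2 \<circ> u})"
    using finite_Sn[of n] by (simp add: card_cartesian_product card_Sn)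
  finally show ?thesis
    unfolding sum_distrib_left .
qed

text \<open>No position is fixed, so \<open>g'\<close> stays as a variable: eliminating
  \<open>z\<close> and then \<open>y\<close> leaves a single equation in \<open>g\<close>,
  \<open>x\<close>, \<open>g'\<close>. With \<open>d = x \<circ> (g' \<circ> inv x)\<close> it says
  that the cubes of \<open>g\<close> and \<open>d\<close> compose to \<open>id\<close>, and
  \<open>x\<close> is free.\<close>

lemma sum_fixed_3_cycle:
  assumes "\<alpha> a = b" "\<alpha> b = c" "\<alpha> c = a"
  shows "(\<Sum>\<gamma>\<^sub>1\<in>Sn n. \<Sum>\<gamma>\<^sub>2\<in>Sn n. card {\<sigma> \<in> triples n. triple_act (\<gamma>\<^sub>1, \<gamma>\<^sub>2, \<alpha>) \<sigma> = \<sigma>}) =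
    fact n * (\<Sum>\<gamma>\<in>Sn n. card {\<sigma> \<in> Sn n. \<gamma> ^^ 3 \<circ> \<sigma> ^^ 3 = id})"
proof -
  let ?S = "Sn n"
  let ?Q = "{(g, g', x, y, z) \<in> ?S \<times> ?S \<times> ?S \<times> ?S \<times> ?S.
    g \<circ> y \<circ> g' = x \<and> g \<circ> z \<circ> g' = y \<and> g \<circ> x \<circ> g' = z}"
  let ?B = "{(g, x, d) \<in> ?S \<times> ?S \<times> ?S. g \<circ> (g \<circ> (g \<circ> (d \<circ> (d \<circ> d)))) = id}"
  let ?F = "\<lambda>(g, g', x, y, z). (g, x, x \<circ> (g' \<circ> inv x))"
  let ?F' = "\<lambda>(g, x, d). (g, inv x \<circ> (d \<circ> x), x, g \<circ> (g \<circ> (d \<circ> (d \<circ> x))), g \<circ> (d \<circ> x))"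
  have fixed: "g \<circ> (g \<circ> (g \<circ> (d \<circ> (d \<circ> (d \<circ> x))))) = x"
    if "g \<circ> (g \<circ> (g \<circ> (d \<circ> (d \<circ> d)))) = id" for g d x
    using arg_cong[OF that, of "\<lambda>w. w \<circ> x"] by (simp add: comp_assoc)
  have "bij_betw ?F ?Q ?B"
  proof (rule bij_betw_byWitness[where f' = ?F'])
    show "\<forall>q\<in>?Q. ?F' (?F q) = q"
    proof
      fix q assume "q \<in> ?Q"
      moreover obtain g g' x y z where q1: "q = (g, g', x, y, z)" by (cases q)
      ultimately have q: "q = (g, g', x, y, z)" "g \<in> ?S" "x \<in> ?S"
        "g \<circ> z \<circ> g' = y" "g \<circ> x \<circ> g' = z" by simp_all
      show "?F' (?F q) = q"
        using q(2,3) unfolding q(1) q(4)[symmetric] q(5)[symmetric] by (simp add: comp_assoc)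
    qed
    show "?F ` ?Q \<subseteq> ?B"
    proof
      fix w assume "w \<in> ?F ` ?Q"
      then obtain g g' x y z where w: "w = (g, x, x \<circ> (g' \<circ> inv x))"
        and q: "g \<in> ?S" "x \<in> ?S" "g' \<in> ?S"
          "g \<circ> y \<circ> g' = x" "g \<circ> z \<circ> g' = y" "g \<circ> x \<circ> g' = z" by auto
      have "g \<circ> (g \<circ> (g \<circ> x \<circ> g') \<circ> g') \<circ> g' \<circ> inv x = id"
        unfolding q(4-6) using q(2) by simp
      then show "w \<in> ?B"
        unfolding w using q(1-3) by (simp add: comp_assoc)
    qed
    show "?F' ` ?B \<subseteq> ?Q"
      using fixed by (auto simp: comp_assoc)
  qed (auto simp: comp_assoc)
  note bij = this
  have "(\<Sum>\<gamma>\<^sub>1\<in>?S. \<Sum>\<gamma>\<^sub>2\<in>?S. card {\<sigma> \<in> triples n. triple_act (\<gamma>\<^sub>1, \<gamma>\<^sub>2, \<alpha>) \<sigma> = \<sigma>}) = card ?Q"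
    by (rule sum_fixed_triples) (simp add: triple_act_fixed_iff assms)
  also have "card ?Q = card ?B"
    by (rule bij_betw_same_card[OF bij])
  also have "?B = (SIGMA g:?S. ?S \<times> {d \<in> ?S. g ^^ 3 \<circ> d ^^ 3 = id})"
    by (auto simp: numeral_3_eq_3 comp_assoc)
  also have "card \<dots> = (\<Sum>g\<in>?S. fact n * card {d \<in> ?S. g ^^ 3 \<circ> d ^^ 3 = id})"
    using finite_Sn[of n] by (simp add: card_cartesian_product card_Sn)
  finally show ?thesis
    unfolding sum_distrib_left .
qed

end

section \<open>The six relabellings and the final count\<close>

lemma Sn_3:
  defines "xs \<equiv> [id, transpose 1 2, transpose 1 3, transpose 2 3,
    transpose 1 2 \<circ> transpose 2 3, transpose 2 3 \<circ> transpose 1 (2 :: nat)]"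
  shows "distinct xs" "Sn 3 = set xs"
proof -
  \<comment> \<open>A permutation of three points is determined by its values at 1 and 2, so these
    separate the list; the cardinality \<open>fact 3\<close> then shows that the list is
    complete.\<close>
  have "distinct (map (\<lambda>f. (f 1, f 2)) xs)"
    unfolding xs_def by (simp add: transpose_def)
  then show d: "distinct xs"
    by (simp add: distinct_map)
  have "set xs \<subseteq> Sn 3"
    unfolding xs_def Sn_def
    by (auto intro!: permutes_id permutes_compose permutes_swap_id)
  moreover have "card (set xs) = card (Sn 3)"
    unfolding distinct_card[OF d] card_Sn by (simp add: xs_def fact_numeral)
  ultimately show "Sn 3 = set xs"
    using card_subset_eq[OF finite_Sn] by metis
qed

text \<open>\<open>Sn 3\<close> has one identity, three transpositions and two 3-cycles; dividing by
  its order 6 gives the weights 1/6, 1/2 and 1/3. One \<open>fact n\<close> of the group order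
  cancels against the free entry, the other is the normalization of the three sums.\<close>

lemma Z3sc_eq:
  "of_nat (Z3sc n) = 1 / 6 * S3_111 n + 1 / 2 * S3_21 n + 1 / 3 * S3_3 n"
proof -
  let ?N = "\<lambda>\<alpha>. \<Sum>\<gamma>\<^sub>1\<in>Sn n. \<Sum>\<gamma>\<^sub>2\<in>Sn n. card {\<sigma> \<in> triples n. triple_act (\<gamma>\<^sub>1, \<gamma>\<^sub>2, \<alpha>) \<sigma> = \<sigma>}"
  let ?a = "\<Sum>\<gamma>\<in>Sn n. card {\<sigma> \<in> Sn n. \<sigma> \<circ> \<gamma> = \<gamma> \<circ> \<sigma>} ^ 2"
  let ?b = "\<Sum>\<gamma>\<in>Sn n. card {\<sigma> \<in> Sn n. \<sigma> \<circ> \<gamma> ^^ 2 = \<gamma> ^^ 2 \<circ> \<sigma>}"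
  let ?c = "\<Sum>\<gamma>\<in>Sn n. card {\<sigma> \<in> Sn n. \<gamma> ^^ 3 \<circ> \<sigma> ^^ 3 = id}"
  have set: "{1..3} = {1, 2, 3 :: nat}" "{1..3} = {1, 3, 2 :: nat}"
    "{1..3} = {2, 3, 1 :: nat}" "{1..3} = {3, 2, 1 :: nat}" by auto
  \<comment> \<open>For a transposition the positions are listed with the swapped pair first, for a
    3-cycle in the order in which it moves them.\<close>
  have N: "?N id = fact n * ?a"
    "?N (transpose 1 2) = fact n * ?b"
    "?N (transpose 1 3) = fact n * ?b"
    "?N (transpose 2 3) = fact n * ?b"
    "?N (transpose 1 2 \<circ> transpose 2 3) = fact n * ?c"
    "?N (transpose 2 3 \<circ> transpose 1 2) = fact n * ?c"
    using sum_fixed_id[OF set(1), of n]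
      sum_fixed_transposition[OF set(1), of "transpose 1 2" n]
      sum_fixed_transposition[OF set(2), of "transpose 1 3" n]
      sum_fixed_transposition[OF set(3), of "transpose 2 3" n]
      sum_fixed_3_cycle[OF set(1), of "transpose 1 2 \<circ> transpose 2 3" n]
      sum_fixed_3_cycle[OF set(2), of "transpose 2 3 \<circ> transpose 1 2" n]
    by (simp_all add: transpose_def)
  have "Z3sc n * (fact n * (fact n * 6)) = fact n * (?a + 3 * ?b + 2 * ?c)"
    unfolding Z3sc_mult_card Sn_3(2) sum.distinct_set_conv_list[OF Sn_3(1)]
    by (simp only: list.map sum_list.Cons sum_list.Nil N) (simp add: algebra_simps)
  then have "fact n * (Z3sc n * (fact n * 6)) = fact n * (?a + 3 * ?b + 2 * ?c)"
    by (simp only: mult.left_commute)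
  then have "Z3sc n * (fact n * 6) = ?a + 3 * ?b + 2 * ?c"
    by (simp only: nat_mult_eq_cancel1[OF fact_gt_zero])
  from arg_cong[OF this, of "of_nat :: nat \<Rightarrow> rat"]
  have "of_nat (Z3sc n) * (fact n * 6) = (of_nat ?a + 3 * of_nat ?b + 2 * of_nat ?c :: rat)"
    by (simp only: of_nat_mult of_nat_add of_nat_fact of_nat_numeral)
  then show ?thesis
    unfolding S3_111_eq_centralizers S3_21_eq_centralizers S3_3_eq_card
    by (simp add: field_simps)
qed

theorem mainTheorem5:
  fixes n :: nat
  assumes "n \<ge> 1"
  shows "(of_nat (Z3sc n) :: rat) = 1 / 6 * S3_111 n + 1 / 2 * S3_21 n + 1 / 3 * S3_3 n
    \<and> S3_111 n = (\<Sum>p\<in>partitions n. of_nat (Sym n p))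
    \<and> S3_21 n = (\<Sum>p\<in>partitions n. Coeff Z2 n p * of_nat (Sym n p))
    \<and> S3_3 n = (\<Sum>p\<in>partitions n. (Coeff Z3 n p) ^ 2 * of_nat (Sym n p))"
  using Z3sc_eq S3_111_eq_Sym S3_21_eq_Coeff S3_3_eq_Coeff by blast

end
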